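(* Let $n\ge 9\times 10^8$, $\beta=\frac{1}{2}\ln n$, $s=\frac{1}{100}\sqrt{n}\ln n$, and let $G$ be a random graph sampled from the hard distribution with parameters $n,\beta,s$ (defined in the context). Let $\gamma=0.04$ and $\delta=\beta\gamma/s=2/\sqrt{n}$. For any $(1,\delta)$-differentially private maximum spanning tree algorithm $M$, $$\mathbb{E}_{G,M}\left[\sum_{e\in M(G)}w_e\right]\le\mathbb{E}_G\left[\sum_{e\in T^*_G}w_e\right]-\frac{n^{3/2}\ln n}{1000},$$ where $T^*_G$ is the maximum spanning tree of $G$.
   Context: Hard distribution: let $G$ be the complete graph on $n$ vertices with $m=n(n-1)/2$ edges. For each edge $e$, independently sample $P_e\sim\mathrm{Beta}(\beta,\beta)$. Then let $X\in\{0,1\}^{s\times m}$ have independent entries, $X_{i,e}$ Bernoulli with mean $P_e$ for $i\in[s]$, $e\in[m]$, and set $w_e=\sum_{i\in[s]}X_{i,e}$. A maximum spanning tree algorithm $M$ takes a weighted graph and outputs a spanning tree (a set of $n-1$ edges); it is $(1,\delta)$-differentially private if for any two weighted graphs on the same vertex and edge sets whose weights differ by at most $1$ on every edge, and every set $Z$ of spanning trees, $\Pr[M(G)\in Z]\le e\cdot\Pr[M(G')\in Z]+\delta$. The maximum spanning tree maximizes the total edge weight. *)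

theory Defs
  imports "HOL-Probability.Probability"
begin

section \<open>Weighted graphs and spanning trees\<close>

text \<open>Simple undirected graphs; an edge is a two-element set of vertices.\<close>

record 'v wgraph =
  verts :: "'v set"
  edges :: "'v set set"
  weight :: "'v set \<Rightarrow> real"

definition joined :: "'v set \<Rightarrow> 'v set set \<Rightarrow> bool" where
  "joined V F \<longleftrightarrow> (\<forall>u\<in>V. \<forall>v\<in>V. (u, v) \<in> {(a, b). {a, b} \<in> F}\<^sup>*)"

text \<open>A cycle is given by the list of its vertices in cyclic order.\<close>

definition has_cycle :: "'v set set \<Rightarrow> bool" where
  "has_cycle F \<longleftrightarrow>
     (\<exists>vs. length vs \<ge> 3 \<and> distinct vs \<and>
        (\<forall>i<length vs. {vs ! i, vs ! ((i + 1) mod length vs)} \<in> F))"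

definition spanning_tree :: "'v wgraph \<Rightarrow> 'v set set \<Rightarrow> bool" where
  "spanning_tree G T \<longleftrightarrow> T \<subseteq> edges G \<and> joined (verts G) T \<and> \<not> has_cycle T"

text \<open>
  Only connected graphs have spanning trees, so connectedness is part of the notion of an
  admissible input. Weights are extensional: a graph carries no information off its edge set
  that an algorithm could depend on.
\<close>

definition connected_wgraph :: "'v wgraph \<Rightarrow> bool" where
  "connected_wgraph G \<longleftrightarrow>
     finite (verts G) \<and> edges G \<subseteq> {e. e \<subseteq> verts G \<and> card e = 2} \<and>
     weight G \<in> extensional (edges G) \<and> joined (verts G) (edges G)"

definition tree_weight :: "'v wgraph \<Rightarrow> 'v set set \<Rightarrow> real" where
  "tree_weight G T = (\<Sum>e\<in>T. weight G e)"

definition max_spanning_tree :: "'v wgraph \<Rightarrow> 'v set set \<Rightarrow> bool" where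
  "max_spanning_tree G T \<longleftrightarrow> is_arg_max (tree_weight G) (spanning_tree G) T"

section \<open>Private spanning tree algorithms\<close>

definition mst_algorithm :: "('v wgraph \<Rightarrow> 'v set set pmf) \<Rightarrow> bool" where
  "mst_algorithm M \<longleftrightarrow>
     (\<forall>G. connected_wgraph G \<longrightarrow> set_pmf (M G) \<subseteq> {T. spanning_tree G T})"

definition neighbouring :: "'v wgraph \<Rightarrow> 'v wgraph \<Rightarrow> bool" where
  "neighbouring G G' \<longleftrightarrow>
     verts G = verts G' \<and> edges G = edges G' \<and>
     (\<forall>e\<in>edges G. \<bar>weight G e - weight G' e\<bar> \<le> 1)"

definition differentially_private ::
  "real \<Rightarrow> real \<Rightarrow> ('v wgraph \<Rightarrow> 'v set set pmf) \<Rightarrow> bool" where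
  "differentially_private \<epsilon> \<delta> M \<longleftrightarrow>
     (\<forall>G G'. connected_wgraph G \<longrightarrow> connected_wgraph G' \<longrightarrow> neighbouring G G' \<longrightarrow>
        (\<forall>Z \<subseteq> {T. spanning_tree G T}.
           measure_pmf.prob (M G) Z \<le> exp \<epsilon> * measure_pmf.prob (M G') Z + \<delta>))"

section \<open>The hard distribution\<close>

definition beta_distr :: "real \<Rightarrow> real \<Rightarrow> real measure" where
  "beta_distr a b =
     density lborel (\<lambda>x. ennreal (indicator {0<..<1} x *
       (x powr (a - 1) * (1 - x) powr (b - 1) / Beta a b)))"

definition complete_edges :: "nat \<Rightarrow> nat set set" where
  "complete_edges n = {e. e \<subseteq> {..<n} \<and> card e = 2}"

text \<open>The graph determined by the bits \<open>X\<close>: edge \<open>e\<close> has weight \<open>\<Sum>i<s. X (i, e)\<close>.\<close>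

definition bit_graph :: "nat \<Rightarrow> nat \<Rightarrow> (nat \<times> nat set \<Rightarrow> bool) \<Rightarrow> nat wgraph" where
  "bit_graph n s X =
     \<lparr>verts = {..<n}, edges = complete_edges n,
      weight = (\<lambda>e\<in>complete_edges n. \<Sum>i<s. of_bool (X (i, e)))\<rparr>"

text \<open>The law of the graph for fixed edge probabilities \<open>P\<close>.\<close>

definition bernoulli_graph :: "nat \<Rightarrow> nat \<Rightarrow> (nat set \<Rightarrow> real) \<Rightarrow> nat wgraph pmf" where
  "bernoulli_graph n s P =
     map_pmf (bit_graph n s)
       (Pi_pmf ({..<s} \<times> complete_edges n) False (\<lambda>(i, e). bernoulli_pmf (P e)))"

definition hard_distribution :: "nat \<Rightarrow> real \<Rightarrow> nat \<Rightarrow> nat wgraph measure" where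
  "hard_distribution n \<beta> s =
     (\<Pi>\<^sub>M e\<in>complete_edges n. beta_distr \<beta> \<beta>) \<bind> (\<lambda>P. measure_pmf (bernoulli_graph n s P))"

text \<open>
  The Giry bind is only meaningful for measurable kernels; the following facts show that it is
  used correctly here.
\<close>

lemma sets_beta_distr [simp, measurable_cong]: "sets (beta_distr a b) = sets borel"
  by (simp add: beta_distr_def)

lemma space_beta_distr [simp]: "space (beta_distr a b) = UNIV"
  by (simp add: beta_distr_def)

lemma prob_space_beta_distr:
  assumes "a > 0" "b > 0"
  shows "prob_space (beta_distr a b)"
proof
  let ?f = "\<lambda>x::real. x powr (a - 1) * (1 - x) powr (b - 1)"
  have B: "Beta a b > 0"
    using assms by (simp add: Beta_def Gamma_real_pos)
  have "(?f has_integral Beta a b) {0<..<1}"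
    using has_integral_Beta_real[OF assms] by (simp add: has_integral_Icc_iff_Ioo)
  from has_integral_divide[OF this, of "Beta a b"]
  have J: "((\<lambda>x. ?f x / Beta a b) has_integral 1) {0<..<1}"
    using B by simp
  have I: "((\<lambda>x. indicator {0<..<1} x * (?f x / Beta a b)) has_integral 1) UNIV"
  proof -
    have eq: "(\<lambda>x. indicator {0<..<1} x * (?f x / Beta a b)) =
        (\<lambda>x. if x \<in> {0<..<1} then ?f x / Beta a b else 0)"
      by (auto simp: indicator_def)
    from J show ?thesis
      unfolding eq has_integral_restrict_UNIV .
  qed
  have "(\<integral>\<^sup>+ x. ennreal (indicator {0<..<1} x * (?f x / Beta a b)) \<partial>lborel) = ennreal 1"
    by (rule nn_integral_has_integral_lborel[OF _ _ I]) (use B in \<open>auto simp: indicator_def\<close>)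
  thus "emeasure (beta_distr a b) (space (beta_distr a b)) = 1"
    unfolding beta_distr_def by (subst emeasure_density) auto
qed

lemma finite_complete_edges [simp]: "finite (complete_edges n)"
  by (rule finite_subset[of _ "Pow {..<n}"]) (auto simp: complete_edges_def)

lemma measurable_pmf_bernoulli:
  "(\<lambda>p::real. pmf (bernoulli_pmf p) b) \<in> borel_measurable borel"
proof -
  have "(\<lambda>p::real. pmf (bernoulli_pmf p) b) =
        (\<lambda>p. if b then min 1 (max 0 p) else 1 - min 1 (max 0 p))"
    by (rule ext) (cases b; simp add: bernoulli_pmf.rep_eq)
  thus ?thesis by simp
qed

lemma measurable_bernoulli_graph:
  "(\<lambda>P. measure_pmf (bernoulli_graph n s P))
     \<in> measurable (\<Pi>\<^sub>M e\<in>complete_edges n. beta_distr a b) (subprob_algebra (count_space UNIV))"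
proof (rule measurable_subprob_algebra)
  fix A :: "nat wgraph set"
  let ?I = "{..<s} \<times> complete_edges n"
  let ?S = "{f. \<forall>x. f x \<longrightarrow> x \<in> ?I} :: (nat \<times> nat set \<Rightarrow> bool) set"
  let ?B = "?S \<inter> bit_graph n s -` A"
  have fin: "finite ?S"
  proof -
    have "?S \<subseteq> (\<lambda>J x. x \<in> J) ` Pow ?I"
      by (auto intro!: image_eqI[of _ _ "Collect f" for f])
    thus ?thesis by (rule finite_subset) auto
  qed
  have "emeasure (measure_pmf (bernoulli_graph n s P)) A =
      ennreal (\<Sum>f\<in>?B. \<Prod>x\<in>?I. pmf (bernoulli_pmf (P (snd x))) (f x))" for P
  proof -
    let ?p = "Pi_pmf ?I False (\<lambda>(i, e). bernoulli_pmf (P e))"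
    have sub: "set_pmf ?p \<subseteq> ?S"
      using set_Pi_pmf_subset[of ?I False "\<lambda>(i, e). bernoulli_pmf (P e)"] by auto
    have "emeasure (measure_pmf (bernoulli_graph n s P)) A =
        emeasure (measure_pmf ?p) (bit_graph n s -` A)"
      by (simp add: bernoulli_graph_def)
    also have "\<dots> = emeasure (measure_pmf ?p) ?B"
      using sub by (intro emeasure_eq_AE) (auto simp: AE_measure_pmf_iff)
    also have "\<dots> = ennreal (\<Sum>f\<in>?B. pmf ?p f)"
      using fin by (simp add: measure_pmf.emeasure_eq_measure measure_measure_pmf_finite)
    also have "(\<Sum>f\<in>?B. pmf ?p f) =
        (\<Sum>f\<in>?B. \<Prod>x\<in>?I. pmf (bernoulli_pmf (P (snd x))) (f x))"
      by (intro sum.cong refl) (subst pmf_Pi; auto simp: case_prod_unfold)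
    finally show ?thesis .
  qed
  moreover have "(\<lambda>P. ennreal (\<Sum>f\<in>?B. \<Prod>x\<in>?I. pmf (bernoulli_pmf (P (snd x))) (f x)))
      \<in> borel_measurable (\<Pi>\<^sub>M e\<in>complete_edges n. beta_distr a b)"
    by (intro measurable_compose[OF _ measurable_ennreal] borel_measurable_sum
          borel_measurable_prod measurable_compose[OF _ measurable_pmf_bernoulli]) auto
  ultimately show "(\<lambda>P. emeasure (measure_pmf (bernoulli_graph n s P)) A)
      \<in> borel_measurable (\<Pi>\<^sub>M e\<in>complete_edges n. beta_distr a b)"
    by simp
qed (auto intro: prob_space_imp_subprob_space measure_pmf.prob_space_axioms)

lemma prob_space_hard_distribution:
  assumes "\<beta> > 0"
  shows "prob_space (hard_distribution n \<beta> s)"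
proof -
  interpret prob_space "\<Pi>\<^sub>M e\<in>complete_edges n. beta_distr \<beta> \<beta>"
    by (intro prob_space_PiM prob_space_beta_distr assms)
  show ?thesis
    unfolding hard_distribution_def
    by (rule prob_space_bind[OF _ measurable_bernoulli_graph])
       (simp add: measure_pmf.prob_space_axioms)
qed

end

theory Submission
  imports Defs
begin

text \<open>
  Write \<open>P\<close> for the edge probabilities and \<open>T\<close> for the output of the algorithm. Since the Beta prior is
  conjugate, \<open>E[w\<^sub>e | X] = E[(s + 2\<beta>) P\<^sub>e - \<beta> | X]\<close>, so in expectation the weight of \<open>T\<close> exceeds \<open>s \<Sum> P\<^sub>e\<close> by exactly
  \<open>\<beta> \<Sum> (2 P\<^sub>e - 1)\<close>, sums over \<open>e \<in> T\<close>: selecting edges of large \<open>P\<^sub>e\<close> forces \<open>T\<close> to be correlated with the rows of \<open>X\<close>.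
  Privacy bounds the correlation with each row by \<open>e \<surd>n / 2 + n \<delta>\<close>, and hence the expected weight of \<open>T\<close>
  by \<open>0.54 s n\<close>. On the other hand, joining every vertex to an earlier one along an edge with
  \<open>P\<^sub>e \<ge> 3/4\<close>, which exists for all but few vertices with high probability, gives a spanning tree of expected
  weight at least \<open>0.69 s n\<close>.
\<close>

section \<open>Forests and spanning trees\<close>

lemma has_cycle_mono:
  assumes "has_cycle F" "F \<subseteq> F'"
  shows "has_cycle F'"
  using assms unfolding has_cycle_def by blast

lemma two_elem_edge:
  assumes "card e = 2" "v \<in> e"
  obtains u where "u \<noteq> v" "e = {v, u}"
  using assms by (metis card_2_iff' card_2_iff insert_commute insert_iff singletonD)

text \<open>Consider a longest path. By maximality all neighbours of its first vertex lie on the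
  path, and a second neighbour besides the next vertex closes an initial segment to a cycle.\<close>

lemma has_cycle_if_min_degree_2:
  assumes V: "finite V" "V \<noteq> {}" and F: "F \<subseteq> {e. e \<subseteq> V \<and> card e = 2}"
    and deg: "\<And>v. v \<in> V \<Longrightarrow> \<exists>e\<in>F. \<exists>e'\<in>F. e \<noteq> e' \<and> v \<in> e \<and> v \<in> e'"
  shows "has_cycle F"
proof -
  define P where "P = (\<lambda>p. p \<noteq> [] \<and> distinct p \<and> set p \<subseteq> V \<and>
    (\<forall>i. Suc i < length p \<longrightarrow> {p ! i, p ! Suc i} \<in> F))"
  obtain v0 where "v0 \<in> V" using V by auto
  hence "P [v0]" by (simp add: P_def)
  moreover have "length p < Suc (card V)" if "P p" for p
    using that V by (metis P_def card_mono distinct_card less_Suc_eq_le)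
  ultimately obtain p where p: "P p" and longest: "\<And>q. P q \<Longrightarrow> length q \<le> length p"
    using ex_has_greatest_nat[of P "[v0]" length "Suc (card V)"] by (metis less_imp_le)
  define v where "v = p ! 0"
  have v: "v \<in> V" using p by (auto simp: P_def v_def)
  have neighbour_in_path: "u \<in> set p" if "{v, u} \<in> F" "u \<noteq> v" for u
  proof (rule ccontr)
    assume u: "u \<notin> set p"
    have "{(u # p) ! i, (u # p) ! Suc i} \<in> F" if "Suc i < length (u # p)" for i
      using that p \<open>{v, u} \<in> F\<close> by (cases i) (auto simp: P_def v_def insert_commute)
    moreover have "u \<in> V" using F that by auto
    ultimately have "P (u # p)" using p u by (simp add: P_def)
    from longest[OF this] show False by simp
  qed
  obtain u1 u2 where u: "u1 \<noteq> v" "{v, u1} \<in> F" "u2 \<noteq> v" "{v, u2} \<in> F" "u1 \<noteq> u2"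
  proof -
    from deg[OF v] obtain e e' where e: "e \<in> F" "e' \<in> F" "e \<noteq> e'" "v \<in> e" "v \<in> e'" by blast
    from e F obtain u where "u \<noteq> v" "e = {v, u}" using two_elem_edge[of e v] by auto
    moreover from e F obtain u' where "u' \<noteq> v" "e' = {v, u'}" using two_elem_edge[of e' v] by auto
    ultimately show ?thesis using that e by blast
  qed
  obtain j where j: "j \<ge> 2" "j < length p" "{v, p ! j} \<in> F"
  proof -
    obtain j1 where j1: "j1 < length p" "u1 = p ! j1"
      using neighbour_in_path u by (metis in_set_conv_nth)
    obtain j2 where j2: "j2 < length p" "u2 = p ! j2"
      using neighbour_in_path u by (metis in_set_conv_nth)
    have "j1 \<noteq> 0" "j2 \<noteq> 0" "j1 \<noteq> j2" using u j1 j2 by (metis v_def)+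
    \<comment> \<open>Positions 0 and 1 cannot accommodate two distinct neighbours of the vertex at
      position 0. An index of at least 2 gives the closed segment the three vertices that
      \<open>has_cycle\<close> demands.\<close>
    hence "j1 \<ge> 2 \<or> j2 \<ge> 2" by linarith
    thus ?thesis using that j1 j2 u by blast
  qed
  define vs where "vs = take (Suc j) p"
  have len: "length vs = Suc j" using j by (simp add: vs_def)
  have "{vs ! i, vs ! ((i + 1) mod length vs)} \<in> F" if "i < length vs" for i
  proof (cases "i = j")
    case True
    thus ?thesis using j len by (simp add: vs_def v_def insert_commute)
  next
    case False
    hence "i < j" using that len by simp
    thus ?thesis using j p by (simp add: vs_def P_def)
  qed
  moreover have "distinct vs" using p by (simp add: vs_def P_def)
  ultimately show ?thesis
    unfolding has_cycle_def using len j by (intro exI[of _ vs]) auto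
qed

text \<open>Induction on the number of vertices: an acyclic graph has a vertex on at most one edge,
  and deleting it costs at most that edge. The bound without the usual -1 is precise enough for the
  later estimates.\<close>

lemma card_forest_le:
  assumes "finite V" "F \<subseteq> {e. e \<subseteq> V \<and> card e = 2}" "\<not> has_cycle F"
  shows "card F \<le> card V"
  using assms
proof (induction "card V" arbitrary: V F)
  case 0
  hence "F = {}" by (auto simp: card_2_iff)
  thus ?case by simp
next
  case (Suc k)
  from Suc have "V \<noteq> {}" by auto
  have finF: "finite F"
    using Suc.prems by (auto intro: finite_subset[of _ "Pow V"])
  from has_cycle_if_min_degree_2[OF _ \<open>V \<noteq> {}\<close>] Suc.prems obtain v where v: "v \<in> V"
    and deg: "\<And>e e'. e \<in> F \<Longrightarrow> e' \<in> F \<Longrightarrow> v \<in> e \<Longrightarrow> v \<in> e' \<Longrightarrow> e = e'" by metis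
  let ?F' = "{e \<in> F. v \<notin> e}" and ?D = "{e \<in> F. v \<in> e}"
  have "card ?F' \<le> card (V - {v})"
  proof (rule Suc.hyps)
    show "k = card (V - {v})" using Suc.hyps v Suc.prems by simp
    show "?F' \<subseteq> {e. e \<subseteq> V - {v} \<and> card e = 2}" using Suc.prems by auto
    show "\<not> has_cycle ?F'" using Suc.prems has_cycle_mono[of ?F' F] by auto
  qed (use Suc.prems in auto)
  moreover have "card ?D \<le> 1"
    using deg finF by (subst One_nat_def, subst card_le_Suc0_iff_eq) auto
  moreover have "card F = card ?F' + card ?D"
    using finF by (subst card_Un_disjoint[symmetric]) (auto intro!: arg_cong[of _ _ card])
  moreover have "card V = Suc (card (V - {v}))" using v Suc.prems by (metis card.remove)
  ultimately show ?case by linarith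
qed

text \<open>The child is recovered from its edge as the larger endpoint.\<close>

lemma parent_edge_inj:
  assumes "\<And>v. v \<in> {1..<n} \<Longrightarrow> par v < v"
  shows "inj_on (\<lambda>v::nat. {v, par v}) {1..<n}"
proof (rule inj_onI)
  fix v w assume *: "v \<in> {1..<n}" "w \<in> {1..<n}" "{v, par v} = {w, par w}"
  with assms[of v] assms[of w] show "v = w" by (metis doubleton_eq_iff less_asym)
qed

text \<open>Following parents descends to 0, which gives connectedness. In a cycle the largest
  vertex would have two distinct smaller neighbours, yet its only smaller neighbour is its
  parent.\<close>

lemma spanning_tree_parents:
  fixes par :: "nat \<Rightarrow> nat"
  assumes G: "verts G = {..<n}" "edges G = complete_edges n"
    and par: "\<And>v. v \<in> {1..<n} \<Longrightarrow> par v < v"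
  shows "spanning_tree G ((\<lambda>v. {v, par v}) ` {1..<n})" (is "spanning_tree G ?T")
proof -
  let ?R = "{(a, b). {a, b} \<in> ?T}"
  have "?T \<subseteq> complete_edges n"
  proof
    fix e assume "e \<in> ?T"
    then obtain v where "v \<in> {1..<n}" "e = {v, par v}" by blast
    with par[of v] show "e \<in> complete_edges n"
      by (auto simp: complete_edges_def)
  qed
  moreover have "joined {..<n} ?T"
  proof -
    have sym: "sym (?R\<^sup>*)" by (intro sym_rtrancl symI) (auto simp: insert_commute)
    have root: "(v, 0) \<in> ?R\<^sup>*" if "v < n" for v
      using that
    proof (induction v rule: less_induct)
      case (less v)
      show ?case
      proof (cases "v = 0")
        case False
        with less.prems have v: "v \<in> {1..<n}" by simp
        have "(v, par v) \<in> ?R" using v by blast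
        moreover have "(par v, 0) \<in> ?R\<^sup>*" using less par[OF v] by simp
        ultimately show ?thesis by (rule converse_rtrancl_into_rtrancl)
      qed simp
    qed
    show ?thesis unfolding joined_def
      using root sym by (meson lessThan_iff rtrancl_trans symD)
  qed
  moreover have "\<not> has_cycle ?T"
  proof
    assume "has_cycle ?T"
    then obtain vs where len: "length vs \<ge> 3" and dist: "distinct vs"
      and cyc: "\<And>i. i < length vs \<Longrightarrow> {vs ! i, vs ! ((i + 1) mod length vs)} \<in> ?T"
      unfolding has_cycle_def by blast
    let ?L = "length vs"
    define v where "v = Max (set vs)"
    have "vs \<noteq> []" using len by auto
    hence "v \<in> set vs" by (simp add: v_def)
    then obtain k where k: "k < ?L" "v = vs ! k" by (metis in_set_conv_nth)
    have parent: "a = par v" if "{v, a} \<in> ?T" "a \<in> set vs" "a \<noteq> v" for a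
    proof -
      have "a < v" using that by (simp add: v_def order_le_neq_trans)
      from that obtain w where "w \<in> {1..<n}" "{v, a} = {w, par w}" by blast
      with par[of w] \<open>a < v\<close> show ?thesis by (auto simp: doubleton_eq_iff)
    qed
    define i where "i = (if Suc k = ?L then 0 else Suc k)"
    define j where "j = (if k = 0 then ?L - 1 else k - 1)"
    \<comment> \<open>\<open>i\<close> and \<open>j\<close> are the cyclic successor and predecessor
      of \<open>k\<close>; they differ because the cycle has at least three vertices.\<close>
    have ij: "i < ?L" "j < ?L" "i \<noteq> k" "j \<noteq> k" "i \<noteq> j"
      using k len by (auto simp: i_def j_def split: if_splits)
    have "(k + 1) mod ?L = i" "(j + 1) mod ?L = k"
      using k len by (auto simp: i_def j_def)
    with cyc[of k] cyc[of j] k ij have "{v, vs ! i} \<in> ?T" "{v, vs ! j} \<in> ?T"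
      by (auto simp: insert_commute)
    moreover have "vs ! i \<noteq> v" "vs ! j \<noteq> v"
      using ij k dist by (auto simp: nth_eq_iff_index_eq)
    ultimately have "vs ! i = par v" "vs ! j = par v"
      using parent ij by (meson nth_mem)+
    thus False using ij dist by (metis nth_eq_iff_index_eq)
  qed
  ultimately show ?thesis by (simp add: spanning_tree_def G)
qed

section \<open>Graphs built from bit matrices\<close>

lemma verts_bit_graph [simp]: "verts (bit_graph n s X) = {..<n}"
  and edges_bit_graph [simp]: "edges (bit_graph n s X) = complete_edges n"
  by (simp_all add: bit_graph_def)

lemma weight_bit_graph:
  "e \<in> complete_edges n \<Longrightarrow> weight (bit_graph n s X) e = (\<Sum>i<s. of_bool (X (i, e)))"
  by (simp add: bit_graph_def)

lemma connected_bit_graph: "connected_wgraph (bit_graph n s X)"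
proof -
  have "joined {..<n} (complete_edges n)"
    unfolding joined_def
  proof (intro ballI)
    fix u v assume "u \<in> {..<n}" "v \<in> {..<n}"
    thus "(u, v) \<in> {(a, b). {a, b} \<in> complete_edges n}\<^sup>*"
      by (cases "u = v") (auto simp: complete_edges_def card_2_iff)
  qed
  thus ?thesis by (auto simp: connected_wgraph_def bit_graph_def complete_edges_def)
qed

lemma card_spanning_tree_le:
  assumes "connected_wgraph G" "spanning_tree G T"
  shows "finite T" "card T \<le> card (verts G)"
proof -
  have "T \<subseteq> {e. e \<subseteq> verts G \<and> card e = 2}" "finite (verts G)" "\<not> has_cycle T"
    using assms by (auto simp: connected_wgraph_def spanning_tree_def)
  thus "finite T" "card T \<le> card (verts G)"
    by (auto intro: card_forest_le finite_subset[of _ "Pow (verts G)"])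
qed

lemma max_spanning_tree_weight_ge:
  assumes "max_spanning_tree G T" "spanning_tree G T'"
  shows "tree_weight G T' \<le> tree_weight G T"
  using assms by (auto simp: max_spanning_tree_def is_arg_max_def not_less)

section \<open>Correlation of a private tree with a row of the bit matrix\<close>

text \<open>Extends privacy from events to functions with values in [0, B]. Only trees in the event
  \<open>Z\<close> contribute positively to the difference of the two sides, and there
  \<open>g\<close> is at most \<open>B\<close>; so one application of privacy to \<open>Z\<close>
  suffices and \<open>\<delta>\<close> is lost only once, scaled by \<open>B\<close>.\<close>

lemma private_expectation_le:
  fixes g :: "nat set set \<Rightarrow> real" and \<epsilon> \<delta> B :: real
  assumes alg: "mst_algorithm M" and dp: "differentially_private \<epsilon> \<delta> M"
    and G: "connected_wgraph G" "connected_wgraph G'" "neighbouring G G'"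
    and g: "\<And>T. spanning_tree G T \<Longrightarrow> 0 \<le> g T \<and> g T \<le> B" and "0 \<le> B"
  shows "measure_pmf.expectation (M G) g \<le> exp \<epsilon> * measure_pmf.expectation (M G') g + B * \<delta>"
proof -
  define S where "S = {T. spanning_tree G T}"
  have "finite (edges G)"
    using G by (auto simp: connected_wgraph_def intro: finite_subset[of _ "Pow (verts G)"])
  moreover have "S \<subseteq> Pow (edges G)" by (auto simp: S_def spanning_tree_def)
  ultimately have fin: "finite S" by (meson finite_Pow_iff finite_subset)
  have sub: "set_pmf (M G) \<subseteq> S" "set_pmf (M G') \<subseteq> S"
  proof -
    have "spanning_tree G' = spanning_tree G"
      using G by (simp add: fun_eq_iff spanning_tree_def neighbouring_def)
    moreover have "set_pmf (M G) \<subseteq> {T. spanning_tree G T}" "set_pmf (M G') \<subseteq> {T. spanning_tree G' T}"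
      using alg G by (simp_all add: mst_algorithm_def)
    ultimately show "set_pmf (M G) \<subseteq> S" "set_pmf (M G') \<subseteq> S" by (simp_all add: S_def)
  qed
  have E: "measure_pmf.expectation p g = (\<Sum>T\<in>S. g T * pmf p T)" if "set_pmf p \<subseteq> S" for p
    using that by (intro integral_measure_pmf_real fin) auto
  define Z where "Z = {T \<in> S. pmf (M G) T > exp \<epsilon> * pmf (M G') T}"
  have fZ: "finite Z" using fin by (simp add: Z_def)
  have dpZ: "measure_pmf.prob (M G) Z \<le> exp \<epsilon> * measure_pmf.prob (M G') Z + \<delta>"
  proof -
    have "Z \<subseteq> {T. spanning_tree G T}" by (auto simp: Z_def S_def)
    thus ?thesis using dp G unfolding differentially_private_def by blast
  qed
  have "(\<Sum>T\<in>S. g T * pmf (M G) T) - exp \<epsilon> * (\<Sum>T\<in>S. g T * pmf (M G') T) =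
      (\<Sum>T\<in>S. g T * (pmf (M G) T - exp \<epsilon> * pmf (M G') T))"
    by (simp add: sum_distrib_left sum_subtractf algebra_simps)
  also have "\<dots> \<le> (\<Sum>T\<in>S. if T \<in> Z then B * (pmf (M G) T - exp \<epsilon> * pmf (M G') T) else 0)"
  proof (rule sum_mono)
    fix T assume T: "T \<in> S"
    hence "0 \<le> g T" "g T \<le> B" using g by (auto simp: S_def)
    thus "g T * (pmf (M G) T - exp \<epsilon> * pmf (M G') T) \<le>
        (if T \<in> Z then B * (pmf (M G) T - exp \<epsilon> * pmf (M G') T) else 0)"
      using T by (auto simp: Z_def mult_right_mono mult_nonneg_nonpos)
  qed
  also have "\<dots> = (\<Sum>T\<in>Z. B * (pmf (M G) T - exp \<epsilon> * pmf (M G') T))"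
    using fin by (subst sum.If_cases) (auto simp: Z_def intro!: sum.cong)
  also have "\<dots> = B * (measure_pmf.prob (M G) Z - exp \<epsilon> * measure_pmf.prob (M G') Z)"
    using fZ by (simp add: measure_measure_pmf_finite sum_distrib_left sum_subtractf algebra_simps)
  also have "\<dots> \<le> B * \<delta>"
    using dpZ \<open>0 \<le> B\<close> by (intro mult_left_mono) auto
  finally show ?thesis using E sub by simp
qed

section \<open>Moments of finite products of Bernoulli variables\<close>

lemma Pi_pmf_expectation_component:
  fixes h :: "'b \<Rightarrow> real"
  assumes "finite I" "x \<in> I"
  shows "measure_pmf.expectation (Pi_pmf I d p) (\<lambda>X. h (X x)) = measure_pmf.expectation (p x) h"
  using assms Pi_pmf_component[of I x d p] integral_map_pmf[of "\<lambda>f. f x" "Pi_pmf I d p" h]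
  by simp

lemma finite_set_Pi_bernoulli:
  assumes "finite I"
  shows "finite (set_pmf (Pi_pmf I False (\<lambda>x. bernoulli_pmf (p x))))"
  using finite_PiE_dflt[OF assms, of "\<lambda>_. UNIV" False]
  by (intro finite_subset[OF set_Pi_pmf_subset[OF assms]]) (simp add: PiE_dflt_def)

lemma integrable_Pi_bernoulli:
  fixes f :: "('a \<Rightarrow> bool) \<Rightarrow> real"
  assumes "finite I"
  shows "integrable (measure_pmf (Pi_pmf I False (\<lambda>x. bernoulli_pmf (p x)))) f"
  by (intro integrable_measure_pmf_finite finite_set_Pi_bernoulli assms)

text \<open>Expanding the square, the off-diagonal terms factor by independence and vanish because
  the variables are centred.\<close>

lemma (in prob_space) expectation_square_sum_indep:
  fixes Y :: "'i \<Rightarrow> 'a \<Rightarrow> real"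
  assumes fin: "finite J" and indep: "indep_vars (\<lambda>_. borel) Y J"
    and int: "\<And>x. x \<in> J \<Longrightarrow> integrable M (Y x)"
    and int2: "\<And>x. x \<in> J \<Longrightarrow> integrable M (\<lambda>\<omega>. (Y x \<omega>)\<^sup>2)"
    and mean: "\<And>x. x \<in> J \<Longrightarrow> expectation (Y x) = 0"
  shows "expectation (\<lambda>\<omega>. (\<Sum>x\<in>J. Y x \<omega>)\<^sup>2) = (\<Sum>x\<in>J. expectation (\<lambda>\<omega>. (Y x \<omega>)\<^sup>2))"
proof -
  have pair: "indep_var borel (Y x) borel (Y y)" if "x \<in> J" "y \<in> J" "x \<noteq> y" for x y
    using indep_vars_sum[of "{y}" x Y] indep_vars_subset[OF indep, of "{x, y}"] that by simp
  have int_prod: "integrable M (\<lambda>\<omega>. Y x \<omega> * Y y \<omega>)" if "x \<in> J" "y \<in> J" for x y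
    using that int int2 by (cases "x = y") (auto simp: power2_eq_square intro!: indep_var_integrable pair)
  have cross: "expectation (\<lambda>\<omega>. Y x \<omega> * Y y \<omega>) = (if x = y then expectation (\<lambda>\<omega>. (Y x \<omega>)\<^sup>2) else 0)"
    if "x \<in> J" "y \<in> J" for x y
    using that int mean
    by (cases "x = y") (simp_all add: power2_eq_square indep_var_lebesgue_integral[OF pair])
  have "expectation (\<lambda>\<omega>. (\<Sum>x\<in>J. Y x \<omega>)\<^sup>2) = (\<Sum>x\<in>J. \<Sum>y\<in>J. expectation (\<lambda>\<omega>. Y x \<omega> * Y y \<omega>))"
    by (simp add: power2_eq_square sum_product Bochner_Integration.integral_sum int_prod)
  also have "\<dots> = (\<Sum>x\<in>J. \<Sum>y\<in>J. if x = y then expectation (\<lambda>\<omega>. (Y x \<omega>)\<^sup>2) else 0)"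
    by (intro sum.cong refl cross)
  finally show ?thesis using fin by simp
qed

text \<open>Each centred bit has variance p (1 - p), which is at most 1/4, and variances of
  independent bits add up.\<close>

lemma second_moment_Pi_bernoulli:
  fixes P :: "'a \<Rightarrow> real"
  assumes fin: "finite I" and J: "J \<subseteq> I" and P: "\<And>x. x \<in> I \<Longrightarrow> 0 \<le> P x \<and> P x \<le> 1"
  shows "measure_pmf.expectation (Pi_pmf I False (\<lambda>x. bernoulli_pmf (P x)))
      (\<lambda>X. (\<Sum>x\<in>J. of_bool (X x) - P x)\<^sup>2) \<le> card J / 4"
proof -
  let ?D = "Pi_pmf I False (\<lambda>x. bernoulli_pmf (P x))"
  define Y where "Y = (\<lambda>x X. of_bool (X x) - P x :: real)"
  note ps = measure_pmf.prob_space_axioms[of ?D]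
  have indep: "prob_space.indep_vars (measure_pmf ?D) (\<lambda>_. borel) Y I"
    unfolding Y_def
    by (rule prob_space.indep_vars_compose2[OF ps indep_vars_Pi_pmf[OF fin],
          where Y = "\<lambda>x b. of_bool b - P x"]) auto
  have mean: "measure_pmf.expectation ?D (Y x) = 0" if "x \<in> I" for x
    using that P Pi_pmf_expectation_component[OF fin that,
        where h = "\<lambda>b. of_bool b - P x" and d = False and p = "\<lambda>x. bernoulli_pmf (P x)"]
    by (simp add: Y_def algebra_simps)
  have var: "measure_pmf.expectation ?D (\<lambda>X. (Y x X)\<^sup>2) \<le> 1 / 4" if x: "x \<in> I" for x
  proof -
    have "measure_pmf.expectation ?D (\<lambda>X. (Y x X)\<^sup>2) = P x * (1 - P x)"
      using x P[OF x] Pi_pmf_expectation_component[OF fin x,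
          where h = "\<lambda>b. (of_bool b - P x)\<^sup>2" and d = False and p = "\<lambda>x. bernoulli_pmf (P x)"]
      by (simp add: Y_def power2_eq_square algebra_simps)
    also have "0 \<le> (P x - 1/2)\<^sup>2" by simp
    hence "P x * (1 - P x) \<le> 1 / 4" by (simp add: power2_eq_square algebra_simps)
    finally show ?thesis .
  qed
  have "measure_pmf.expectation ?D (\<lambda>X. (\<Sum>x\<in>J. Y x X)\<^sup>2) =
      (\<Sum>x\<in>J. measure_pmf.expectation ?D (\<lambda>X. (Y x X)\<^sup>2))"
    using J fin mean
    by (intro prob_space.expectation_square_sum_indep[OF ps] prob_space.indep_vars_subset[OF ps indep]
          integrable_Pi_bernoulli) (auto intro: finite_subset)
  also have "\<dots> \<le> (\<Sum>x\<in>J. 1 / 4)" using J by (intro sum_mono var) auto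
  finally show ?thesis by (simp add: Y_def)
qed

text \<open>The randomness of \<open>bernoulli_graph\<close> before it is collapsed to a graph: the
  argument needs single rows of bits, which the edge weights no longer determine.\<close>

definition bits_pmf :: "nat \<Rightarrow> nat \<Rightarrow> (nat set \<Rightarrow> real) \<Rightarrow> (nat \<times> nat set \<Rightarrow> bool) pmf" where
  "bits_pmf n s P = Pi_pmf ({..<s} \<times> complete_edges n) False (\<lambda>x. bernoulli_pmf (P (snd x)))"

lemma bernoulli_graph_bits: "bernoulli_graph n s P = map_pmf (bit_graph n s) (bits_pmf n s P)"
  by (simp add: bernoulli_graph_def bits_pmf_def case_prod_unfold)

lemma integrable_bits_pmf:
  fixes f :: "_ \<Rightarrow> real"
  shows "integrable (measure_pmf (bits_pmf n s P)) f"
  unfolding bits_pmf_def by (rule integrable_Pi_bernoulli) auto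

lemma expectation_pair_pmf_prod:
  fixes a :: "'a \<Rightarrow> real" and b :: "'b \<Rightarrow> real"
  assumes "finite (set_pmf p)" "finite (set_pmf q)"
  shows "measure_pmf.expectation (pair_pmf p q) (\<lambda>(x, y). a x * b y) =
    measure_pmf.expectation p a * measure_pmf.expectation q b"
proof -
  have "measure_pmf.expectation (pair_pmf p q) (\<lambda>(x, y). a x * b y) =
      (\<Sum>(x, y)\<in>set_pmf p \<times> set_pmf q. (a x * b y) * pmf (pair_pmf p q) (x, y))"
    using assms by (subst integral_measure_pmf_real[where A = "set_pmf p \<times> set_pmf q"])
      (auto simp: case_prod_unfold)
  also have "\<dots> = (\<Sum>x\<in>set_pmf p. a x * pmf p x) * (\<Sum>y\<in>set_pmf q. b y * pmf q y)"
    by (simp add: sum_product sum.cartesian_product pmf_pair mult_ac)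
  finally show ?thesis
    using assms by (subst (1 2) integral_measure_pmf_real) auto
qed

text \<open>The graph obtained by clearing row \<open>i\<close> is a neighbour whose tree is independent of that
  row, so there the correlation is a centred sum with standard deviation at most
  \<open>sqrt n / 2\<close>.\<close>

lemma row_correlation_le:
  fixes n s i :: nat and P :: "nat set \<Rightarrow> real" and \<epsilon> \<delta> :: real
  assumes alg: "mst_algorithm M" and dp: "differentially_private \<epsilon> \<delta> M"
    and i: "i < s" and n: "n > 0"
    and P: "\<And>e. e \<in> complete_edges n \<Longrightarrow> 0 \<le> P e \<and> P e \<le> 1"
  shows "measure_pmf.expectation (bits_pmf n s P)
      (\<lambda>X. measure_pmf.expectation (M (bit_graph n s X))
        (\<lambda>T. \<bar>\<Sum>e\<in>T. of_bool (X (i, e)) - P e\<bar>)) \<le> exp \<epsilon> * sqrt n / 2 + n * \<delta>"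
proof -
  define E where "E = complete_edges n"
  define A where "A = {i} \<times> E"
  define B where "B = ({..<s} - {i}) \<times> E"
  define p where "p = (\<lambda>x :: nat \<times> nat set. bernoulli_pmf (P (snd x)))"
  define pA where "pA = Pi_pmf A False p"
  define pB where "pB = Pi_pmf B False p"
  define h where "h = (\<lambda>(f, g) (x :: nat \<times> nat set). if x \<in> A then f x else g x :: bool)"
  define z where "z = (\<lambda>(f :: nat \<times> nat set \<Rightarrow> bool) T. \<bar>\<Sum>e\<in>T. of_bool (f (i, e)) - P e\<bar>)"
  \<comment> \<open>Being a spanning tree does not depend on the weights, so the
    all-\<open>False\<close> matrix stands for every matrix here.\<close>
  define S where "S = {T. spanning_tree (bit_graph n s (\<lambda>_. False)) T}"
  define c where "c = sqrt n / 2"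
  have c: "c > 0" "c\<^sup>2 = n / 4" using n by (auto simp: c_def power2_eq_square)
  have finE: "finite E" by (simp add: E_def)
  have fin: "finite A" "finite B" using finE by (auto simp: A_def B_def)
  have S: "spanning_tree (bit_graph n s X) T \<longleftrightarrow> T \<in> S" for X T
    by (simp add: S_def spanning_tree_def)
  have S_sub: "T \<subseteq> E" if "T \<in> S" for T using that by (simp add: S_def spanning_tree_def E_def)
  have S_card: "finite T" "card T \<le> n" if "T \<in> S" for T
    using that card_spanning_tree_le[OF connected_bit_graph, of n s "\<lambda>_. False" T] by (auto simp: S_def)
  have "S \<subseteq> Pow E" using S_sub by auto
  hence finS: "finite S" using finE by (meson finite_Pow_iff finite_subset)
  have setM: "set_pmf (M (bit_graph n s X)) \<subseteq> S" for X
    using alg connected_bit_graph[of n s X] S by (auto simp: mst_algorithm_def)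
  have fpA: "finite (set_pmf pA)" and fpB: "finite (set_pmf pB)"
    unfolding pA_def pB_def p_def by (intro finite_set_Pi_bernoulli fin)+
  have bits: "bits_pmf n s P = map_pmf h (pair_pmf pA pB)"
  proof -
    have "{..<s} \<times> complete_edges n = A \<union> B" using i by (auto simp: A_def B_def E_def)
    moreover have "A \<inter> B = {}" by (auto simp: A_def B_def)
    ultimately show ?thesis
      unfolding bits_pmf_def pA_def pB_def h_def p_def by (simp add: Pi_pmf_union fin)
  qed
  have zB: "0 \<le> z f T \<and> z f T \<le> n" if "T \<in> S" for f T
  proof -
    have "z f T \<le> (\<Sum>e\<in>T. \<bar>of_bool (f (i, e)) - P e\<bar>)" unfolding z_def by (rule sum_abs)
    also have "\<dots> \<le> (\<Sum>e\<in>T. 1)"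
    proof (rule sum_mono)
      fix e assume "e \<in> T"
      hence "0 \<le> P e" "P e \<le> 1" using P S_sub[OF that] by (auto simp: E_def)
      thus "\<bar>of_bool (f (i, e)) - P e\<bar> \<le> 1" by (cases "f (i, e)") auto
    qed
    also have "\<dots> \<le> n" using S_card[OF that] by simp
    finally show ?thesis by (simp add: z_def)
  qed
  have priv: "measure_pmf.expectation (M (bit_graph n s (h (f, g)))) (z f) \<le>
      exp \<epsilon> * measure_pmf.expectation (M (bit_graph n s g)) (z f) + n * \<delta>"
    if g: "g \<in> set_pmf pB" for f g
  proof (rule private_expectation_le[OF alg dp connected_bit_graph connected_bit_graph])
    \<comment> \<open>Row \<open>i\<close> lies outside the index set \<open>B\<close>, where
      \<open>Pi_pmf\<close> takes its default \<open>False\<close>. Hence \<open>g\<close> itself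
      encodes the matrix with row \<open>i\<close> cleared, and each edge weight changes by at most
      one bit.\<close>
    have g0: "\<not> g (i, e)" for e
      using g set_Pi_pmf_subset[OF fin(2), of False p] by (auto simp: pB_def B_def)
    have "\<bar>(\<Sum>j<s. of_bool (h (f, g) (j, e))) - (\<Sum>j<s. of_bool (g (j, e)))\<bar> \<le> (1::real)"
      if "e \<in> E" for e
    proof -
      have "(\<Sum>j<s. of_bool (h (f, g) (j, e))) - (\<Sum>j<s. of_bool (g (j, e)) :: real) =
          (\<Sum>j<s. if j = i then of_bool (f (i, e)) else 0)"
        unfolding sum_subtractf[symmetric]
        using that g0 by (intro sum.cong) (auto simp: h_def A_def)
      thus ?thesis using i by simp
    qed
    thus "neighbouring (bit_graph n s (h (f, g))) (bit_graph n s g)"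
      by (simp add: neighbouring_def weight_bit_graph E_def)
  qed (use zB S in auto)
  have row: "measure_pmf.expectation pA (\<lambda>f. z f T) \<le> c" if "T \<in> S" for T
  proof -
    have inj: "inj_on (Pair i) T" by (rule inj_onI) simp
    have sub: "Pair i ` T \<subseteq> A" using S_sub[OF that] by (auto simp: A_def)
    have "0 \<le> P (snd x) \<and> P (snd x) \<le> 1" if "x \<in> A" for x
      using P that by (auto simp: A_def E_def)
    note moment = second_moment_Pi_bernoulli[OF fin(1) sub, of "\<lambda>x. P (snd x)", OF this]
    have intA: "integrable pA f" for f :: "_ \<Rightarrow> real"
      by (intro integrable_measure_pmf_finite fpA)
    have "measure_pmf.expectation pA (\<lambda>f. (z f T)\<^sup>2) \<le> card (Pair i ` T) / 4"
      using moment by (simp add: pA_def p_def z_def sum.reindex[OF inj])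
    also have "\<dots> \<le> c\<^sup>2" using S_card[OF that] by (simp add: card_image[OF inj] c)
    finally have 2: "measure_pmf.expectation pA (\<lambda>f. (z f T)\<^sup>2) \<le> c\<^sup>2" .
    \<comment> \<open>The inequality between arithmetic and geometric means replaces Cauchy-Schwarz:
      it turns a second moment of at most \<open>c\<^sup>2\<close> into a first moment of at most
      \<open>c\<close>.\<close>
    have "z f T \<le> ((z f T)\<^sup>2 / c + c) / 2" for f
    proof -
      have "0 \<le> (z f T - c)\<^sup>2" by simp
      thus ?thesis using c(1) by (simp add: power2_eq_square field_simps)
    qed
    hence "measure_pmf.expectation pA (\<lambda>f. z f T) \<le> measure_pmf.expectation pA (\<lambda>f. ((z f T)\<^sup>2 / c + c) / 2)"
      by (intro integral_mono intA)
    also have "\<dots> = (measure_pmf.expectation pA (\<lambda>f. (z f T)\<^sup>2) / c + c) / 2"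
      by (simp add: intA)
    also have "\<dots> \<le> (c\<^sup>2 / c + c) / 2"
      using 2 c(1) by (intro divide_right_mono add_right_mono) auto
    finally show ?thesis using c(1) by (simp add: power2_eq_square)
  qed
  have int: "integrable (pair_pmf pA pB) F" for F :: "_ \<Rightarrow> real"
    by (intro integrable_measure_pmf_finite) (simp add: fpA fpB)
  let ?Q = "\<lambda>g T. pmf (M (bit_graph n s g)) T"
  have zh: "\<bar>\<Sum>e\<in>T. of_bool (h fg (i, e)) - P e\<bar> = z (fst fg) T"
    if "T \<in> set_pmf (M (bit_graph n s (h fg)))" for fg T
  proof -
    have "T \<subseteq> E" using S_sub setM that by blast
    thus ?thesis by (auto simp: z_def h_def A_def split: prod.splits intro!: arg_cong[of _ _ abs] sum.cong)
  qed
  have "measure_pmf.expectation (bits_pmf n s P)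
      (\<lambda>X. measure_pmf.expectation (M (bit_graph n s X)) (\<lambda>T. \<bar>\<Sum>e\<in>T. of_bool (X (i, e)) - P e\<bar>))
    = measure_pmf.expectation (pair_pmf pA pB)
      (\<lambda>fg. measure_pmf.expectation (M (bit_graph n s (h fg))) (z (fst fg)))"
    unfolding bits integral_map_pmf
    by (intro integral_cong_AE AE_pmfI zh) auto
  also have "\<dots> \<le> measure_pmf.expectation (pair_pmf pA pB)
      (\<lambda>(f, g). exp \<epsilon> * measure_pmf.expectation (M (bit_graph n s g)) (z f) + n * \<delta>)"
    by (intro integral_mono_AE int AE_pmfI) (auto intro: priv)
  \<comment> \<open>The tree now depends on \<open>g\<close> alone. Expanding over the finitely many
    trees leaves products of a function of \<open>f\<close> and a function of \<open>g\<close>,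
    whose expectations factor.\<close>
  also have "\<dots> = measure_pmf.expectation (pair_pmf pA pB)
      (\<lambda>fg. exp \<epsilon> * (\<Sum>T\<in>S. (case fg of (f, g) \<Rightarrow> z f T * ?Q g T)) + n * \<delta>)"
    by (intro Bochner_Integration.integral_cong refl)
      (auto intro!: integral_measure_pmf_real finS dest: subsetD[OF setM])
  also have "\<dots> = exp \<epsilon> * (\<Sum>T\<in>S. measure_pmf.expectation (pair_pmf pA pB) (\<lambda>(f, g). z f T * ?Q g T)) + n * \<delta>"
    by (simp add: int Bochner_Integration.integral_sum)
  also have "\<dots> = exp \<epsilon> * (\<Sum>T\<in>S. measure_pmf.expectation pA (\<lambda>f. z f T) * measure_pmf.expectation pB (\<lambda>g. ?Q g T)) + n * \<delta>"
    by (simp add: expectation_pair_pmf_prod fpA fpB)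
  also have "\<dots> \<le> exp \<epsilon> * (\<Sum>T\<in>S. c * measure_pmf.expectation pB (\<lambda>g. ?Q g T)) + n * \<delta>"
    by (intro add_right_mono mult_left_mono sum_mono mult_right_mono row) auto
  also have "(\<Sum>T\<in>S. c * measure_pmf.expectation pB (\<lambda>g. ?Q g T)) =
      c * measure_pmf.expectation pB (\<lambda>g. \<Sum>T\<in>S. ?Q g T)"
    by (subst Bochner_Integration.integral_sum)
      (auto simp: sum_distrib_left intro!: integrable_measure_pmf_finite fpB)
  \<comment> \<open>The uniform row bound has been pulled out, so only the total probability of all
    trees remains.\<close>
  also have "(\<lambda>g. \<Sum>T\<in>S. ?Q g T) = (\<lambda>g. 1)"
    using finS setM by (intro ext sum_pmf_eq_1)
  finally show ?thesis by (simp add: c_def)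
qed

section \<open>Conjugacy of the Beta prior\<close>

lemma Beta_pos: "a > 0 \<Longrightarrow> b > 0 \<Longrightarrow> Beta a b > (0::real)"
  by (simp add: Beta_def Gamma_real_pos)

lemma AE_beta_distr: "AE p in beta_distr a b. 0 < p \<and> p < 1"
  unfolding beta_distr_def by (subst AE_density) (auto simp: indicator_def)

text \<open>The factor \<open>p ^ k * (1 - p) ^ l\<close> turns the density into a multiple of the
  Beta density with parameters \<open>a + k\<close> and \<open>b + l\<close>, which has mass 1; what
  remains is the quotient of normalising constants.\<close>

lemma beta_distr_moment:
  assumes a: "a > 0" and b: "b > 0"
  shows "has_bochner_integral (beta_distr a b) (\<lambda>p. p ^ k * (1 - p) ^ l) (Beta (a + k) (b + l) / Beta a b)"
proof (rule has_bochner_integral_nn_integral)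
  let ?C = "Beta (a + k) (b + l) / Beta a b"
  let ?d = "\<lambda>a b x::real. indicator {0<..<1} x * (x powr (a - 1) * (1 - x) powr (b - 1) / Beta a b)"
  have pos: "Beta a b > 0" "Beta (a + k) (b + l) > 0" using a b by (auto intro!: Beta_pos)
  have "(\<integral>\<^sup>+p. ennreal (p ^ k * (1 - p) ^ l) \<partial>beta_distr a b) =
      (\<integral>\<^sup>+p. ennreal (?d a b p) * ennreal (p ^ k * (1 - p) ^ l) \<partial>lborel)"
    unfolding beta_distr_def by (subst nn_integral_density) auto
  also have "\<dots> = (\<integral>\<^sup>+p. ennreal ?C * ennreal (?d (a + k) (b + l) p) \<partial>lborel)"
  proof (rule nn_integral_cong)
    fix p :: real
    show "ennreal (?d a b p) * ennreal (p ^ k * (1 - p) ^ l) = ennreal ?C * ennreal (?d (a + k) (b + l) p)"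
    proof (cases "p \<in> {0<..<1}")
      case True
      hence "p powr (a + k - 1) = p powr (a - 1) * p ^ k"
        "(1 - p) powr (b + l - 1) = (1 - p) powr (b - 1) * (1 - p) ^ l"
        by (simp_all add: powr_realpow[symmetric] powr_add[symmetric] algebra_simps)
      thus ?thesis using True pos by (simp add: ennreal_mult[symmetric])
    qed simp
  qed
  also have "\<dots> = ennreal ?C * emeasure (beta_distr (a + k) (b + l)) (space (beta_distr (a + k) (b + l)))"
    unfolding beta_distr_def by (subst emeasure_density) (auto simp: nn_integral_cmult)
  also have "emeasure (beta_distr (a + k) (b + l)) (space (beta_distr (a + k) (b + l))) = 1"
    using a b by (intro prob_space.emeasure_space_1 prob_space_beta_distr) auto
  finally show "(\<integral>\<^sup>+p. ennreal (p ^ k * (1 - p) ^ l) \<partial>beta_distr a b) = ennreal ?C" by simp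
  show "0 \<le> ?C" using pos by simp
  show "AE p in beta_distr a b. 0 \<le> p ^ k * (1 - p) ^ l"
    using AE_beta_distr[of a b] by eventually_elim auto
qed auto

lemma prod_bernoulli:
  assumes "0 < p" "p < 1"
  shows "(\<Prod>i<s. pmf (bernoulli_pmf p) (x i)) = p ^ card {i. i < s \<and> x i} * (1 - p) ^ (s - card {i. i < s \<and> x i})"
proof -
  let ?K = "{i. i < s \<and> x i}"
  have "(\<Prod>i<s. pmf (bernoulli_pmf p) (x i)) = (\<Prod>i<s. if x i then p else 1 - p)"
    using assms by (intro prod.cong) auto
  also have "\<dots> = p ^ card ({..<s} \<inter> {i. x i}) * (1 - p) ^ card ({..<s} \<inter> - {i. x i})"
    by (simp add: prod.If_cases)
  also have "{..<s} \<inter> {i. x i} = ?K" by auto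
  also have "{..<s} \<inter> - {i. x i} = {..<s} - ?K" by auto
  also have "card \<dots> = s - card ?K" by (subst card_Diff_subset) auto
  finally show ?thesis .
qed

text \<open>The posterior of \<open>p\<close> given \<open>k\<close> successes in \<open>s\<close> trials is \<open>Beta (\<beta> + k) (\<beta> + s - k)\<close>,
  whose mean is \<open>(\<beta> + k) / (2 * \<beta> + s)\<close>.\<close>

lemma beta_bernoulli_posterior:
  fixes \<beta> :: real and s :: nat and x :: "nat \<Rightarrow> bool"
  assumes "\<beta> > 0"
  defines "\<phi> \<equiv> \<lambda>p. \<Prod>i<s. pmf (bernoulli_pmf p) (x i)"
  shows "integrable (beta_distr \<beta> \<beta>) \<phi>"
    and "integrable (beta_distr \<beta> \<beta>) (\<lambda>p. \<phi> p * p)"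
    and "(\<integral>p. \<phi> p * ((\<Sum>i<s. of_bool (x i)) + \<beta> - (s + 2 * \<beta>) * p) \<partial>beta_distr \<beta> \<beta>) = 0"
proof -
  define k where "k = card {i. i < s \<and> x i}"
  define l where "l = s - k"
  have "k \<le> card {..<s}" unfolding k_def by (rule card_mono) auto
  hence k: "k + l = s" by (simp add: l_def)
  have w: "(\<Sum>i<s. of_bool (x i)) = real k"
    by (simp add: k_def of_bool_def sum.If_cases Int_def)
  have [measurable]: "\<phi> \<in> borel_measurable borel"
    unfolding \<phi>_def by (intro borel_measurable_prod measurable_pmf_bernoulli)
  have \<phi>: "AE p in beta_distr \<beta> \<beta>. \<phi> p = p ^ k * (1 - p) ^ l"
    using AE_beta_distr by eventually_elim (auto simp: \<phi>_def prod_bernoulli k_def l_def)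
  have \<phi>': "AE p in beta_distr \<beta> \<beta>. \<phi> p * p = p ^ Suc k * (1 - p) ^ l"
    using \<phi> by eventually_elim auto
  have 0: "has_bochner_integral (beta_distr \<beta> \<beta>) \<phi> (Beta (\<beta> + k) (\<beta> + l) / Beta \<beta> \<beta>)"
    using beta_distr_moment[OF assms(1) assms(1), of k l] \<phi>
    by (subst has_bochner_integral_cong_AE) auto
  have 1: "has_bochner_integral (beta_distr \<beta> \<beta>) (\<lambda>p. \<phi> p * p) (Beta (\<beta> + Suc k) (\<beta> + l) / Beta \<beta> \<beta>)"
    using beta_distr_moment[OF assms(1) assms(1), of "Suc k" l] \<phi>'
    by (subst has_bochner_integral_cong_AE) auto
  show int: "integrable (beta_distr \<beta> \<beta>) \<phi>" "integrable (beta_distr \<beta> \<beta>) (\<lambda>p. \<phi> p * p)"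
    using 0 1 by (auto simp: has_bochner_integral_iff)
  have "(\<integral>p. \<phi> p * ((\<Sum>i<s. of_bool (x i)) + \<beta> - (s + 2 * \<beta>) * p) \<partial>beta_distr \<beta> \<beta>) =
      (\<integral>p. (k + \<beta>) * \<phi> p - (s + 2 * \<beta>) * (\<phi> p * p) \<partial>beta_distr \<beta> \<beta>)"
    by (intro Bochner_Integration.integral_cong refl) (simp add: w algebra_simps)
  also have "\<dots> = (k + \<beta>) * (Beta (\<beta> + k) (\<beta> + l) / Beta \<beta> \<beta>) -
      (s + 2 * \<beta>) * (Beta (\<beta> + Suc k) (\<beta> + l) / Beta \<beta> \<beta>)"
    using 0 1 int by (simp add: has_bochner_integral_iff)
  \<comment> \<open>This is the recurrence (x + y) Beta (x + 1) y = x Beta x y at x = \<beta> + k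
    and y = \<beta> + l, where x + y = s + 2 \<beta>.\<close>
  also have "(s + 2 * \<beta>) * Beta (\<beta> + Suc k) (\<beta> + l) = (k + \<beta>) * Beta (\<beta> + k) (\<beta> + l)"
  proof -
    have "\<beta> + k \<notin> \<int>\<^sub>\<le>\<^sub>0" using assms(1) by (auto elim!: nonpos_Ints_cases)
    from Beta_plus1_left[OF this, of "\<beta> + l"] show ?thesis by (simp add: k[symmetric] algebra_simps)
  qed
  hence "(s + 2 * \<beta>) * (Beta (\<beta> + Suc k) (\<beta> + l) / Beta \<beta> \<beta>) =
      (k + \<beta>) * (Beta (\<beta> + k) (\<beta> + l) / Beta \<beta> \<beta>)" by (simp add: field_simps)
  finally show "(\<integral>p. \<phi> p * ((\<Sum>i<s. of_bool (x i)) + \<beta> - (s + 2 * \<beta>) * p) \<partial>beta_distr \<beta> \<beta>) = 0"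
    by simp
qed

section \<open>Integrating bit probabilities against the product prior\<close>

abbreviation prior :: "nat \<Rightarrow> real \<Rightarrow> (nat set \<Rightarrow> real) measure" where
  "prior n \<beta> \<equiv> \<Pi>\<^sub>M e\<in>complete_edges n. beta_distr \<beta> \<beta>"

abbreviation edge_weight :: "nat \<Rightarrow> (nat \<times> nat set \<Rightarrow> bool) \<Rightarrow> nat set \<Rightarrow> real" where
  "edge_weight s X e \<equiv> \<Sum>i<s. of_bool (X (i, e))"

lemma prob_space_prior: "\<beta> > 0 \<Longrightarrow> prob_space (prior n \<beta>)"
  by (intro prob_space_PiM prob_space_beta_distr)

text \<open>\<open>bernoulli_pmf\<close> truncates its parameter to [0, 1]; this lets
  \<open>P e\<close> be read as the true mean almost surely.\<close>

lemma AE_prior: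
  assumes "\<beta> > 0"
  shows "AE P in prior n \<beta>. \<forall>e\<in>complete_edges n. 0 < P e \<and> P e < 1"
proof -
  have "AE P in prior n \<beta>. 0 < P e \<and> P e < 1" if "e \<in> complete_edges n" for e
    by (rule AE_PiM_component[where P = "\<lambda>p. 0 < p \<and> p < 1", OF prob_space_beta_distr[OF assms assms] that AE_beta_distr])
  thus ?thesis by (subst AE_ball_countable) (auto intro: countable_finite)
qed

text \<open>Grouping the bits by edge makes each factor a function of a single \<open>P e\<close>,
  matching the product structure of the prior.\<close>

lemma pmf_bits:
  "pmf (bits_pmf n s P) X = (if \<forall>x. x \<notin> {..<s} \<times> complete_edges n \<longrightarrow> \<not> X x
     then \<Prod>e\<in>complete_edges n. \<Prod>i<s. pmf (bernoulli_pmf (P e)) (X (i, e)) else 0)"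
proof -
  have "(\<Prod>x\<in>{..<s} \<times> complete_edges n. pmf (bernoulli_pmf (P (snd x))) (X x)) =
      (\<Prod>e\<in>complete_edges n. \<Prod>i<s. pmf (bernoulli_pmf (P e)) (X (i, e)))"
    by (subst prod.swap) (auto simp: prod.cartesian_product intro!: prod.cong)
  thus ?thesis unfolding bits_pmf_def by (subst pmf_Pi) auto
qed

text \<open>The finite set is chosen before \<open>P\<close> and \<open>f\<close>, so integrating
  over \<open>P\<close> only involves finite sums of likelihoods.\<close>

lemma bits_expectation_eq:
  obtains S where "finite S" "\<And>P f. measure_pmf.expectation (bits_pmf n s P) f = (\<Sum>X\<in>S. f X * pmf (bits_pmf n s P) X)"
proof -
  let ?S = "{X. \<forall>x. x \<notin> {..<s} \<times> complete_edges n \<longrightarrow> \<not> X x}"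
  have "finite ?S"
    using finite_PiE_dflt[of "{..<s} \<times> complete_edges n" "\<lambda>_. UNIV" False] by (simp add: PiE_dflt_def)
  moreover from this have "measure_pmf.expectation (bits_pmf n s P) f = (\<Sum>X\<in>?S. f X * pmf (bits_pmf n s P) X)" for P f
    by (rule integral_measure_pmf_real) (auto simp: set_pmf_iff pmf_bits split: if_splits)
  ultimately show ?thesis by (rule that)
qed

text \<open>For fixed \<open>X\<close> the likelihood is a product over edges, so the integral
  factors; the last claim holds because the factor of \<open>e\<close> vanishes by
  \<open>beta_bernoulli_posterior\<close>.\<close>

lemma integral_pmf_bits:
  fixes \<beta> :: real
  assumes "\<beta> > 0"
  shows "integrable (prior n \<beta>) (\<lambda>P. pmf (bits_pmf n s P) X)"
    and "e \<in> complete_edges n \<Longrightarrow> integrable (prior n \<beta>) (\<lambda>P. pmf (bits_pmf n s P) X * P e)"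
    and "e \<in> complete_edges n \<Longrightarrow>
      (\<integral>P. pmf (bits_pmf n s P) X * (edge_weight s X e + \<beta> - (s + 2 * \<beta>) * P e) \<partial>prior n \<beta>) = 0"
proof -
  interpret product_sigma_finite "\<lambda>_ :: nat set. beta_distr \<beta> \<beta>"
    using prob_space_beta_distr[OF assms assms]
    by (intro product_sigma_finite.intro) (simp add: prob_space_imp_sigma_finite)
  let ?E = "complete_edges n"
  define \<phi> where "\<phi> = (\<lambda>e p. \<Prod>i<s. pmf (bernoulli_pmf p) (X (i, e)))"
  note \<phi> = beta_bernoulli_posterior[OF assms, where s = s]
  have \<phi>_int: "integrable (beta_distr \<beta> \<beta>) (\<phi> e)" for e unfolding \<phi>_def by (rule \<phi>)
  \<comment> \<open>A factor that concerns \<open>e\<close> alone is written as a product over all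
    edges, equal to 1 elsewhere, to allow integration edge by edge.\<close>
  have pick: "(\<Prod>e'\<in>?E. \<phi> e' (P e') * (if e' = e then c (P e') else 1)) = (\<Prod>e'\<in>?E. \<phi> e' (P e')) * c (P e)"
    if "e \<in> ?E" for e P and c :: "real \<Rightarrow> real"
    using that by (simp add: prod.distrib)
  define C where "C \<longleftrightarrow> (\<forall>x. x \<notin> {..<s} \<times> ?E \<longrightarrow> \<not> X x)"
  have *: "pmf (bits_pmf n s P) X = (if C then \<Prod>e\<in>?E. \<phi> e (P e) else 0)" for P
    by (simp only: pmf_bits \<phi>_def C_def)
  have "integrable (prior n \<beta>) (\<lambda>P. \<Prod>e\<in>?E. \<phi> e (P e))"
    by (intro product_integrable_prod \<phi>_int) auto
  thus "integrable (prior n \<beta>) (\<lambda>P. pmf (bits_pmf n s P) X)" by (cases C) (simp_all add: *)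
  assume e: "e \<in> ?E"
  have "integrable (beta_distr \<beta> \<beta>) (\<lambda>p. \<phi> e' p * (if e' = e then p else 1))" for e'
    using \<phi>(1,2) by (cases "e' = e") (simp_all add: \<phi>_def)
  hence "integrable (prior n \<beta>) (\<lambda>P. \<Prod>e'\<in>?E. \<phi> e' (P e') * (if e' = e then P e' else 1))"
    by (intro product_integrable_prod[where f = "\<lambda>e' p. \<phi> e' p * (if e' = e then p else 1)"]) auto
  thus "integrable (prior n \<beta>) (\<lambda>P. pmf (bits_pmf n s P) X * P e)"
    using pick[OF e, where c = "\<lambda>p. p"] by (cases C) (simp_all add: *)
  let ?c = "\<lambda>p. edge_weight s X e + \<beta> - (s + 2 * \<beta>) * p"
  have zero: "(\<integral>p. \<phi> e p * ?c p \<partial>beta_distr \<beta> \<beta>) = 0"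
    unfolding \<phi>_def by (rule \<phi>)
  have "integrable (beta_distr \<beta> \<beta>) (\<lambda>p. \<phi> e' p * (if e' = e then ?c p else 1))" for e'
  proof (cases "e' = e")
    case True
    have "integrable (beta_distr \<beta> \<beta>) (\<lambda>p. (edge_weight s X e + \<beta>) * \<phi> e p - (s + 2 * \<beta>) * (\<phi> e p * p))"
      using \<phi>(1,2) by (intro Bochner_Integration.integrable_diff integrable_mult_right) (simp_all add: \<phi>_def)
    thus ?thesis using True by (simp add: algebra_simps)
  qed (simp add: \<phi>_int)
  hence "(\<integral>P. (\<Prod>e'\<in>?E. \<phi> e' (P e') * (if e' = e then ?c (P e') else 1)) \<partial>prior n \<beta>) =
      (\<Prod>e'\<in>?E. \<integral>p. \<phi> e' p * (if e' = e then ?c p else 1) \<partial>beta_distr \<beta> \<beta>)"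
    by (intro product_integral_prod[where f = "\<lambda>e' p. \<phi> e' p * (if e' = e then ?c p else 1)"]) auto
  also have "\<dots> = 0" using e zero by (intro prod_zero) (auto intro!: bexI[of _ e])
  finally show "(\<integral>P. pmf (bits_pmf n s P) X * ?c (P e) \<partial>prior n \<beta>) = 0"
    by (cases C) (simp_all add: * pick[OF e, where c = ?c] del: sum_of_bool_eq)
qed

lemma integrable_bits_expectation:
  fixes f :: "_ \<Rightarrow> real"
  assumes "\<beta> > 0"
  shows "integrable (prior n \<beta>) (\<lambda>P. measure_pmf.expectation (bits_pmf n s P) f)"
proof -
  obtain S where S: "finite S" "\<And>P f. measure_pmf.expectation (bits_pmf n s P) f = (\<Sum>X\<in>S. f X * pmf (bits_pmf n s P) X)"
    using bits_expectation_eq[of n s] by blast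
  show ?thesis
    unfolding S(2) by (intro Bochner_Integration.integrable_sum integrable_mult_right integral_pmf_bits(1)[OF assms])
qed

text \<open>The posterior identity holds for every fixed \<open>X\<close>, hence survives any
  weighting by a function of \<open>X\<close>. Later \<open>H X e\<close> is the probability that
  the algorithm selects \<open>e\<close>, so the choice may depend on the data in any way.\<close>

lemma fingerprint_identity:
  fixes \<beta> :: real
  assumes "\<beta> > 0"
  shows "has_bochner_integral (prior n \<beta>) (\<lambda>P. measure_pmf.expectation (bits_pmf n s P)
     (\<lambda>X. \<Sum>e\<in>complete_edges n. H X e * (edge_weight s X e + \<beta> - (s + 2 * \<beta>) * P e))) 0"
proof -
  obtain S where S: "finite S" "\<And>P f. measure_pmf.expectation (bits_pmf n s P) f = (\<Sum>X\<in>S. f X * pmf (bits_pmf n s P) X)"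
    using bits_expectation_eq[of n s] by blast
  have "has_bochner_integral (prior n \<beta>) (\<lambda>P. \<Sum>X\<in>S. \<Sum>e\<in>complete_edges n.
      H X e * (pmf (bits_pmf n s P) X * (edge_weight s X e + \<beta> - (s + 2 * \<beta>) * P e))) (\<Sum>X\<in>S. \<Sum>e\<in>complete_edges n. H X e * 0)"
  proof (intro has_bochner_integral_sum has_bochner_integral_mult_right)
    fix X e assume e: "e \<in> complete_edges n"
    have "integrable (prior n \<beta>) (\<lambda>P. (edge_weight s X e + \<beta>) * pmf (bits_pmf n s P) X - (s + 2 * \<beta>) * (pmf (bits_pmf n s P) X * P e))"
      using integral_pmf_bits(1,2)[OF assms] e by (intro Bochner_Integration.integrable_diff integrable_mult_right)
    thus "has_bochner_integral (prior n \<beta>) (\<lambda>P. pmf (bits_pmf n s P) X * (edge_weight s X e + \<beta> - (s + 2 * \<beta>) * P e)) 0"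
      using integral_pmf_bits(3)[OF assms e] by (simp add: has_bochner_integral_iff algebra_simps)
  qed
  thus ?thesis unfolding S(2) by (simp add: sum_distrib_left sum_distrib_right mult_ac)
qed

text \<open>Unfolds the Giry bind for arbitrary \<open>F\<close>: all
  \<open>bernoulli_graph n s P\<close> live on one finite set of graphs, whatever \<open>P\<close>
  is.\<close>

lemma integral_hard_distribution:
  fixes F :: "nat wgraph \<Rightarrow> real"
  assumes "\<beta> > 0"
  shows "(\<integral>G. F G \<partial>hard_distribution n \<beta> s) =
    (\<integral>P. measure_pmf.expectation (bits_pmf n s P) (\<lambda>X. F (bit_graph n s X)) \<partial>prior n \<beta>)"
proof -
  interpret prob_space "prior n \<beta>" by (rule prob_space_prior[OF assms])
  let ?N = "\<lambda>P. measure_pmf (bernoulli_graph n s P)"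
  let ?S = "{X. \<forall>x. x \<notin> {..<s} \<times> complete_edges n \<longrightarrow> \<not> X x}"
  define S where "S = bit_graph n s ` ?S"
  have "finite ?S"
    using finite_PiE_dflt[of "{..<s} \<times> complete_edges n" "\<lambda>_. UNIV" False] by (simp add: PiE_dflt_def)
  hence fin: "finite S" by (simp add: S_def)
  have supp: "set_pmf (bernoulli_graph n s P) \<subseteq> S" for P
    by (auto simp: S_def bernoulli_graph_bits set_pmf_iff pmf_bits split: if_splits)
  \<comment> \<open>\<open>integral_bind\<close> asks for a bounded integrand; cutting
    \<open>F\<close> off outside the finite support provides the bound and changes nothing almost
    everywhere.\<close>
  define F' where "F' = (\<lambda>G. if G \<in> S then F G else 0)"
  have bound: "\<bar>F' G\<bar> \<le> (\<Sum>G\<in>S. \<bar>F G\<bar>)" for G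
    using fin by (auto simp: F'_def intro: member_le_sum sum_nonneg)
  note meas = measurable_bernoulli_graph[of n s \<beta> \<beta>]
  have sets: "sets (hard_distribution n \<beta> s) = UNIV"
    unfolding hard_distribution_def using not_empty by (subst sets_bind_measurable[OF meas]) auto
  have [measurable]: "g \<in> borel_measurable (hard_distribution n \<beta> s)" for g :: "_ \<Rightarrow> real"
    using sets by (auto simp: measurable_def)
  have "(\<integral>G. F G \<partial>hard_distribution n \<beta> s) = (\<integral>G. F' G \<partial>hard_distribution n \<beta> s)"
  proof (rule integral_cong_AE)
    show "AE G in hard_distribution n \<beta> s. F G = F' G"
      unfolding hard_distribution_def
      by (subst AE_bind[OF meas]) (use supp in \<open>auto simp: AE_measure_pmf_iff F'_def\<close>)
  qed auto
  also have "\<dots> = (\<integral>P. (\<integral>G. F' G \<partial>?N P) \<partial>prior n \<beta>)"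
    unfolding hard_distribution_def
    by (rule integral_bind[OF _ bound meas, where B' = 1])
      (auto intro: finite_measure_axioms simp: measure_pmf.emeasure_space_1)
  also have "\<dots> = (\<integral>P. (\<integral>G. F G \<partial>?N P) \<partial>prior n \<beta>)"
    using supp by (intro Bochner_Integration.integral_cong refl integral_cong_AE)
      (auto simp: AE_measure_pmf_iff F'_def)
  finally show ?thesis by (simp add: bernoulli_graph_bits)
qed

section \<open>A heavy spanning tree\<close>

text \<open>On an interval of length 1/10 the density is at least exp (-\<beta>). The normalising
  constant is at most (1/4) powr (\<beta> - 1) because x (1 - x) is at most 1/4, and up to 17/20 the
  product x (1 - x) stays above 51/400; the ratio 51/100 of these two values exceeds 1/e.\<close>

lemma beta_distr_tail:
  fixes \<beta> :: real
  assumes \<beta>: "\<beta> \<ge> 1"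
  shows "exp (- \<beta>) / 10 \<le> measure (beta_distr \<beta> \<beta>) {3/4..}"
proof -
  interpret prob_space "beta_distr \<beta> \<beta>" using \<beta> by (intro prob_space_beta_distr) auto
  have pos: "Beta \<beta> \<beta> > 0" using \<beta> by (intro Beta_pos) auto
  have upper: "Beta \<beta> \<beta> \<le> (1 / 4) powr (\<beta> - 1)"
  proof (rule has_integral_le)
      show "((\<lambda>x. x powr (\<beta> - 1) * (1 - x) powr (\<beta> - 1)) has_integral Beta \<beta> \<beta>) (cbox 0 1)"
        using has_integral_Beta_real[of \<beta> \<beta>] \<beta> by simp
      show "((\<lambda>x. (1 / 4) powr (\<beta> - 1)) has_integral (1 / 4) powr (\<beta> - 1)) (cbox 0 (1::real))"
        using has_integral_const_real[of "(1 / 4) powr (\<beta> - 1)" 0 1] by simp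
      fix x :: real assume x: "x \<in> cbox 0 1"
      have "0 \<le> (x - 1/2)\<^sup>2" by simp
      hence "x * (1 - x) \<le> 1 / 4" by (simp add: power2_eq_square algebra_simps)
      thus "x powr (\<beta> - 1) * (1 - x) powr (\<beta> - 1) \<le> (1 / 4) powr (\<beta> - 1)"
        using x \<beta> by (simp flip: powr_mult) (intro powr_mono2, auto)
  qed
  have density: "exp (- \<beta>) \<le> x powr (\<beta> - 1) * (1 - x) powr (\<beta> - 1) / Beta \<beta> \<beta>"
    if x: "x \<in> {3/4..17/20}" for x
  proof -
    have "exp (- \<beta>) \<le> exp (- (\<beta> - 1))" by simp
    also have "\<dots> = exp (- 1) powr (\<beta> - 1)" by (simp add: powr_def)
    also have "\<dots> \<le> (51 / 100) powr (\<beta> - 1)"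
    proof (rule powr_mono2)
      have "(2::real) \<le> exp 1" using exp_ge_add_one_self[of 1] by simp
      thus "exp (- 1) \<le> (51 / 100 :: real)" by (simp add: exp_minus field_simps)
    qed (use \<beta> in auto)
    also have "\<dots> = (51 / 400) powr (\<beta> - 1) / (1 / 4) powr (\<beta> - 1)"
      by (subst powr_divide[symmetric]) auto
    also have "\<dots> \<le> (51 / 400) powr (\<beta> - 1) / Beta \<beta> \<beta>"
      using upper pos by (intro divide_left_mono) auto
    also have "\<dots> \<le> (x * (1 - x)) powr (\<beta> - 1) / Beta \<beta> \<beta>"
    proof (intro divide_right_mono powr_mono2)
      \<comment> \<open>3/20 is the mirror image of 17/20 about 1/2, so x (1 - x) takes the value
        51/400 at both points.\<close>
      have "0 \<le> (17 / 20 - x) * (x - 3 / 20)" using x by (intro mult_nonneg_nonneg) auto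
      also have "\<dots> = x * (1 - x) - 51 / 400" by (simp add: field_simps)
      finally show "51 / 400 \<le> x * (1 - x)" by simp
    qed (use \<beta> pos in auto)
    finally show ?thesis using x by (simp add: powr_mult)
  qed
  have "ennreal (exp (- \<beta>) / 10) = (\<integral>\<^sup>+x. ennreal (exp (- \<beta>)) * indicator {3/4..17/20::real} x \<partial>lborel)"
    by (subst nn_integral_cmult_indicator) (auto simp: ennreal_mult[symmetric])
  also have "\<dots> \<le> (\<integral>\<^sup>+x. ennreal (indicator {0<..<1} x *
       (x powr (\<beta> - 1) * (1 - x) powr (\<beta> - 1) / Beta \<beta> \<beta>)) * indicator {3/4..17/20} x \<partial>lborel)"
    using density by (intro nn_integral_mono) (auto simp: indicator_def intro!: ennreal_leI)
  also have "\<dots> = emeasure (beta_distr \<beta> \<beta>) {3/4..17/20}"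
    unfolding beta_distr_def by (subst emeasure_density) auto
  also have "\<dots> \<le> emeasure (beta_distr \<beta> \<beta>) {3/4..}"
    by (intro emeasure_mono) auto
  finally show ?thesis by (simp add: emeasure_eq_measure)
qed

text \<open>A rational bound through exp (- v q); its slow decay suffices because v q will be at
  least 30.\<close>

lemma one_minus_power_le:
  fixes q :: real
  assumes "0 \<le> q" "q \<le> 1"
  shows "(1 - q) ^ v \<le> 1 / (1 + v * q)"
proof -
  have "(1 - q) ^ v \<le> exp (- q) ^ v"
    using assms exp_ge_add_one_self[of "- q"] by (intro power_mono) auto
  also have "\<dots> = 1 / exp (v * q)" by (simp add: exp_minus exp_of_nat2_mult field_simps)
  also have "\<dots> \<le> 1 / (1 + v * q)"
    using assms exp_ge_add_one_self[of "v * q"] by (intro divide_left_mono) (auto intro!: mult_pos_pos add_pos_nonneg)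
  finally show ?thesis .
qed

lemma edge_in_complete: "u < v \<Longrightarrow> v < n \<Longrightarrow> {u, v} \<in> complete_edges n"
  by (auto simp: complete_edges_def)

text \<open>The \<open>v\<close> edges from \<open>v\<close> to earlier vertices are distinct, hence
  have independent probabilities; all other edges contribute a factor 1.\<close>

lemma prior_no_heavy_parent:
  fixes \<beta> :: real
  assumes \<beta>: "\<beta> > 0" and v: "v < n"
  shows "has_bochner_integral (prior n \<beta>) (\<lambda>P. \<Prod>u<v. of_bool (P {u, v} < 3 / 4))
    ((1 - measure (beta_distr \<beta> \<beta>) {3/4..}) ^ v)"
proof -
  interpret B: prob_space "beta_distr \<beta> \<beta>" using \<beta> by (intro prob_space_beta_distr)
  interpret product_sigma_finite "\<lambda>_ :: nat set. beta_distr \<beta> \<beta>"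
    by (intro product_sigma_finite.intro) (simp add: B.sigma_finite_measure_axioms)
  let ?E = "complete_edges n" and ?q = "measure (beta_distr \<beta> \<beta>) {3/4..}"
  define A where "A = (\<lambda>u. {u, v}) ` {..<v}"
  have inj: "inj_on (\<lambda>u. {u, v}) {..<v}" by (auto simp: inj_on_def doubleton_eq_iff)
  have A: "A \<subseteq> ?E" using v by (auto simp: A_def intro!: edge_in_complete)
  hence "finite A" by (rule finite_subset) simp
  let ?f = "\<lambda>e (p::real). if e \<in> A then indicator {..<3/4} p else 1 :: real"
  have prod_A: "(\<Prod>e\<in>?E. if e \<in> A then g e else 1) = (\<Prod>e\<in>A. g e)" for g :: "nat set \<Rightarrow> real"
    using A by (subst prod.inter_restrict[symmetric]) (auto simp: Int_absorb1)
  have int: "integrable (beta_distr \<beta> \<beta>) (?f e)" for e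
    by (cases "e \<in> A") (auto intro!: B.integrable_const_bound[where B = 1] simp: indicator_def)
  have one: "(\<integral>p. ?f e p \<partial>beta_distr \<beta> \<beta>) = (if e \<in> A then 1 - ?q else 1)" for e
  proof -
    have "{..<3/4} = space (beta_distr \<beta> \<beta>) - {3/4..}" by auto
    hence "measure (beta_distr \<beta> \<beta>) {..<3/4} = 1 - ?q"
      using B.prob_compl[of "{3/4..}"] by simp
    thus ?thesis using B.prob_space by auto
  qed
  have "(\<lambda>P. \<Prod>u<v. of_bool (P {u, v} < 3 / 4) :: real) = (\<lambda>P. \<Prod>e\<in>?E. ?f e (P e))"
  proof
    fix P :: "nat set \<Rightarrow> real"
    have "(\<Prod>e\<in>?E. ?f e (P e)) = (\<Prod>e\<in>A. indicator {..<3/4} (P e))"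
      by (rule prod_A[of "\<lambda>e. indicator {..<3/4} (P e)"])
    also have "\<dots> = (\<Prod>u<v. of_bool (P {u, v} < 3 / 4))"
      unfolding A_def by (subst prod.reindex[OF inj]) (auto intro!: prod.cong simp: indicator_def)
    finally show "(\<Prod>u<v. of_bool (P {u, v} < 3 / 4)) = (\<Prod>e\<in>?E. ?f e (P e))" by simp
  qed
  moreover have "integrable (prior n \<beta>) (\<lambda>P. \<Prod>e\<in>?E. ?f e (P e))"
    by (intro product_integrable_prod[where f = ?f] int) simp
  moreover have "(\<integral>P. (\<Prod>e\<in>?E. ?f e (P e)) \<partial>prior n \<beta>) = (\<Prod>e\<in>?E. if e \<in> A then 1 - ?q else 1)"
    by (subst product_integral_prod[where f = ?f]) (auto simp: int one)
  moreover have "\<dots> = (1 - ?q) ^ v"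
    unfolding prod_A[of "\<lambda>_. 1 - ?q"] by (simp add: A_def card_image[OF inj])
  ultimately show ?thesis by (simp add: has_bochner_integral_iff)
qed

lemma expectation_edge_weight:
  assumes e: "e \<in> complete_edges n" and P: "0 \<le> P e" "P e \<le> 1"
  shows "measure_pmf.expectation (bits_pmf n s P) (\<lambda>X. edge_weight s X e) = s * P e"
proof -
  have "measure_pmf.expectation (bits_pmf n s P) (\<lambda>X. edge_weight s X e) =
      (\<Sum>i<s. measure_pmf.expectation (bits_pmf n s P) (\<lambda>X. of_bool (X (i, e))))"
    by (intro Bochner_Integration.integral_sum integrable_bits_pmf)
  also have "\<dots> = (\<Sum>i<s. P e)"
  proof (intro sum.cong refl)
    fix i assume "i \<in> {..<s}"
    thus "measure_pmf.expectation (bits_pmf n s P) (\<lambda>X. of_bool (X (i, e)) :: real) = P e"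
      unfolding bits_pmf_def using e P
      by (subst Pi_pmf_expectation_component[where h = of_bool]) auto
  qed
  finally show ?thesis by simp
qed

text \<open>Attach every vertex \<open>v\<close> to some earlier \<open>u\<close> with \<open>P {u, v} \<ge> 3/4\<close>, or to \<open>0\<close> if
  there is none; this tree depends on \<open>P\<close> only.\<close>

lemma max_tree_expectation_ge:
  assumes T_star: "\<And>G. connected_wgraph G \<Longrightarrow> max_spanning_tree G (T_star G)"
    and P: "\<And>e. e \<in> complete_edges n \<Longrightarrow> 0 \<le> P e \<and> P e \<le> 1"
  shows "s * (\<Sum>v\<in>{1..<n}. 3 / 4 * (1 - (\<Prod>u<v. of_bool (P {u, v} < 3 / 4)))) \<le>
    measure_pmf.expectation (bits_pmf n s P) (\<lambda>X. tree_weight (bit_graph n s X) (T_star (bit_graph n s X)))"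
proof -
  define par where "par = (\<lambda>v. if \<exists>u<v. 3 / 4 \<le> P {u, v} then SOME u. u < v \<and> 3 / 4 \<le> P {u, v} else 0)"
  have par_heavy: "par v < v \<and> 3 / 4 \<le> P {par v, v}" if "\<exists>u<v. 3 / 4 \<le> P {u, v}" for v
    using someI_ex[OF that] that by (simp add: par_def)
  have par: "par v < v" if "v \<in> {1..<n}" for v
    using par_heavy[of v] that by (cases "\<exists>u<v. 3 / 4 \<le> P {u, v}") (auto simp: par_def)
  have edge: "{v, par v} \<in> complete_edges n" if "v \<in> {1..<n}" for v
    using edge_in_complete[of "par v" v n] par[OF that] that by (simp add: insert_commute)
  let ?T = "(\<lambda>v. {v, par v}) ` {1..<n}"
  have "s * (\<Sum>v\<in>{1..<n}. 3 / 4 * (1 - (\<Prod>u<v. of_bool (P {u, v} < 3 / 4)))) \<le> s * (\<Sum>v\<in>{1..<n}. P {v, par v})"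
  proof (intro mult_left_mono sum_mono)
    fix v assume v: "v \<in> {1..<n}"
    \<comment> \<open>The product is the indicator that \<open>v\<close> has no heavy edge to an
      earlier vertex. In that case the left side is 0.\<close>
    show "3 / 4 * (1 - (\<Prod>u<v. of_bool (P {u, v} < 3 / 4))) \<le> P {v, par v}"
    proof (cases "\<exists>u<v. 3 / 4 \<le> P {u, v}")
      case True
      hence 0: "(\<Prod>u<v. of_bool (P {u, v} < 3 / 4)) = (0::real)" by (auto simp: not_less)
      have "3 / 4 \<le> P {v, par v}" using par_heavy[OF True] by (simp add: insert_commute)
      thus ?thesis unfolding 0 by simp
    next
      case False
      hence "(\<Prod>u<v. of_bool (P {u, v} < 3 / 4)) = (1::real)" by (intro prod.neutral) (auto simp: not_le)
      thus ?thesis using P[OF edge[OF v]] by simp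
    qed
  qed simp
  also have "\<dots> = (\<Sum>v\<in>{1..<n}. measure_pmf.expectation (bits_pmf n s P) (\<lambda>X. edge_weight s X {v, par v}))"
    using edge P by (simp add: sum_distrib_left expectation_edge_weight del: sum_of_bool_eq)
  also have "\<dots> = measure_pmf.expectation (bits_pmf n s P) (\<lambda>X. \<Sum>v\<in>{1..<n}. edge_weight s X {v, par v})"
    by (intro Bochner_Integration.integral_sum[symmetric] integrable_bits_pmf)
  also have "\<dots> \<le> measure_pmf.expectation (bits_pmf n s P) (\<lambda>X. tree_weight (bit_graph n s X) (T_star (bit_graph n s X)))"
  proof (intro integral_mono integrable_bits_pmf)
    fix X
    have "(\<Sum>v\<in>{1..<n}. edge_weight s X {v, par v}) = tree_weight (bit_graph n s X) ?T"
      unfolding tree_weight_def using edge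
      by (subst sum.reindex[OF parent_edge_inj[OF par]])
        (auto simp: weight_bit_graph simp del: sum_of_bool_eq intro!: sum.cong)
    also have "\<dots> \<le> tree_weight (bit_graph n s X) (T_star (bit_graph n s X))"
      by (rule max_spanning_tree_weight_ge[OF T_star[OF connected_bit_graph]])
        (rule spanning_tree_parents[OF _ _ par], auto)
    finally show "(\<Sum>v\<in>{1..<n}. edge_weight s X {v, par v}) \<le> tree_weight (bit_graph n s X) (T_star (bit_graph n s X))" .
  qed
  finally show ?thesis .
qed

text \<open>Averaging the bound for fixed \<open>P\<close> over the prior replaces each indicator of
  a missing heavy edge by its probability \<open>(1 - q) ^ v\<close>.\<close>

lemma max_tree_integral_ge:
  fixes \<beta> :: real
  assumes T_star: "\<And>G. connected_wgraph G \<Longrightarrow> max_spanning_tree G (T_star G)" and \<beta>: "\<beta> > 0"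
  defines "q \<equiv> measure (beta_distr \<beta> \<beta>) {3/4..}"
  shows "s * (\<Sum>v\<in>{1..<n}. 3 / 4 * (1 - (1 - q) ^ v)) \<le>
    (\<integral>G. (\<Sum>e\<in>T_star G. weight G e) \<partial>hard_distribution n \<beta> s)"
proof -
  interpret prob_space "prior n \<beta>" by (rule prob_space_prior[OF \<beta>])
  let ?h = "\<lambda>v P. \<Prod>u<v. of_bool (P {u, v} < 3 / 4) :: real"
  have h: "has_bochner_integral (prior n \<beta>) (?h v) ((1 - q) ^ v)" if "v \<in> {1..<n}" for v
    using prior_no_heavy_parent[OF \<beta>, of v n] that by (simp add: q_def)
  have "has_bochner_integral (prior n \<beta>) (\<lambda>P. 1::real) 1"
    by (simp add: has_bochner_integral_iff prob_space)
  hence lower: "has_bochner_integral (prior n \<beta>) (\<lambda>P. s * (\<Sum>v\<in>{1..<n}. 3 / 4 * (1 - ?h v P)))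
      (s * (\<Sum>v\<in>{1..<n}. 3 / 4 * (1 - (1 - q) ^ v)))"
    by (intro has_bochner_integral_mult_right has_bochner_integral_sum has_bochner_integral_diff h)
  have "(\<integral>P. s * (\<Sum>v\<in>{1..<n}. 3 / 4 * (1 - ?h v P)) \<partial>prior n \<beta>) \<le>
     (\<integral>P. measure_pmf.expectation (bits_pmf n s P)
        (\<lambda>X. tree_weight (bit_graph n s X) (T_star (bit_graph n s X))) \<partial>prior n \<beta>)"
  proof (rule integral_mono_AE)
    show "integrable (prior n \<beta>) (\<lambda>P. s * (\<Sum>v\<in>{1..<n}. 3 / 4 * (1 - ?h v P)))"
      using lower by (simp only: has_bochner_integral_iff)
    show "AE P in prior n \<beta>. s * (\<Sum>v\<in>{1..<n}. 3 / 4 * (1 - ?h v P)) \<le>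
      measure_pmf.expectation (bits_pmf n s P) (\<lambda>X. tree_weight (bit_graph n s X) (T_star (bit_graph n s X)))"
      using AE_prior[OF \<beta>] by eventually_elim (rule max_tree_expectation_ge[OF T_star], auto simp: less_imp_le)
  qed (rule integrable_bits_expectation[OF \<beta>])
  also have "(\<integral>P. s * (\<Sum>v\<in>{1..<n}. 3 / 4 * (1 - ?h v P)) \<partial>prior n \<beta>) =
      s * (\<Sum>v\<in>{1..<n}. 3 / 4 * (1 - (1 - q) ^ v))"
    using lower by (simp only: has_bochner_integral_iff)
  finally show ?thesis
    by (simp add: integral_hard_distribution[OF \<beta>] tree_weight_def)
qed

section \<open>The weight of a private tree\<close>

lemma finite_set_mst_algorithm:
  assumes alg: "mst_algorithm M" and G: "connected_wgraph G"
  shows "finite (set_pmf (M G))"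
proof (rule finite_subset)
  show "set_pmf (M G) \<subseteq> Pow (edges G)"
    using alg G by (fastforce simp: mst_algorithm_def spanning_tree_def)
  have "finite (edges G)"
    using G by (auto simp: connected_wgraph_def intro: finite_subset[of _ "Pow (verts G)"])
  thus "finite (Pow (edges G))" by simp
qed

text \<open>Turns a sum over a random tree into a sum over fixed edges weighted by inclusion
  probabilities, which are functions of the graph. In this form the algorithm fits into
  \<open>fingerprint_identity\<close>.\<close>

lemma expectation_tree_sum:
  assumes alg: "mst_algorithm M" and G: "connected_wgraph G"
  shows "measure_pmf.expectation (M G) (\<lambda>T. \<Sum>e\<in>T. c e) =
    (\<Sum>e\<in>edges G. measure_pmf.prob (M G) {T. e \<in> T} * c e)"
proof -
  have fin: "finite (edges G)"
    using G by (auto simp: connected_wgraph_def intro: finite_subset[of _ "Pow (verts G)"])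
  have sub: "set_pmf (M G) \<subseteq> Pow (edges G)"
    using alg G by (fastforce simp: mst_algorithm_def spanning_tree_def)
  have "measure_pmf.expectation (M G) (\<lambda>T. \<Sum>e\<in>T. c e) =
      measure_pmf.expectation (M G) (\<lambda>T. \<Sum>e\<in>edges G. indicator {T. e \<in> T} T * c e)"
  proof (intro integral_cong_AE AE_pmfI)
    fix T assume "T \<in> set_pmf (M G)"
    hence "T \<subseteq> edges G" using sub by blast
    thus "(\<Sum>e\<in>T. c e) = (\<Sum>e\<in>edges G. indicator {T. e \<in> T} T * c e)"
      using fin by (intro sum.mono_neutral_cong_left) auto
  qed auto
  also have "\<dots> = (\<Sum>e\<in>edges G. measure_pmf.expectation (M G) (\<lambda>T. indicator {T. e \<in> T} T * c e))"
    by (intro Bochner_Integration.integral_sum integrable_measure_pmf_finite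
        finite_set_mst_algorithm[OF alg G])
  finally show ?thesis by simp
qed

text \<open>An edge weight minus its mean is the sum of the row deviations, so the row bound is
  applied \<open>s\<close> times.\<close>

lemma correlation_le:
  fixes n s :: nat and P :: "nat set \<Rightarrow> real" and \<epsilon> \<delta> :: real
  assumes alg: "mst_algorithm M" and dp: "differentially_private \<epsilon> \<delta> M" and n: "n > 0"
    and P: "\<And>e. e \<in> complete_edges n \<Longrightarrow> 0 \<le> P e \<and> P e \<le> 1"
  shows "measure_pmf.expectation (bits_pmf n s P)
      (\<lambda>X. measure_pmf.expectation (M (bit_graph n s X)) (\<lambda>T. \<Sum>e\<in>T. edge_weight s X e - s * P e))
    \<le> s * (exp \<epsilon> * sqrt n / 2 + n * \<delta>)"
proof -
  let ?z = "\<lambda>i X T. \<Sum>e\<in>T. of_bool (X (i, e)) - P e"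
  have int: "integrable (M (bit_graph n s X)) f" for X and f :: "_ \<Rightarrow> real"
    by (intro integrable_measure_pmf_finite finite_set_mst_algorithm[OF alg connected_bit_graph])
  have "(\<Sum>e\<in>T. edge_weight s X e - s * P e) = (\<Sum>i<s. ?z i X T)" for X T
    by (subst sum.swap) (simp add: sum_subtractf del: sum_of_bool_eq)
  hence "measure_pmf.expectation (bits_pmf n s P)
      (\<lambda>X. measure_pmf.expectation (M (bit_graph n s X)) (\<lambda>T. \<Sum>e\<in>T. edge_weight s X e - s * P e)) =
    (\<Sum>i<s. measure_pmf.expectation (bits_pmf n s P) (\<lambda>X. measure_pmf.expectation (M (bit_graph n s X)) (?z i X)))"
    by (simp only: Bochner_Integration.integral_sum int integrable_bits_pmf)
  also have "\<dots> \<le> (\<Sum>i<s. exp \<epsilon> * sqrt n / 2 + n * \<delta>)"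
  proof (rule sum_mono)
    fix i assume "i \<in> {..<s}"
    hence i: "i < s" by simp
    have "measure_pmf.expectation (bits_pmf n s P) (\<lambda>X. measure_pmf.expectation (M (bit_graph n s X)) (?z i X)) \<le>
      measure_pmf.expectation (bits_pmf n s P) (\<lambda>X. measure_pmf.expectation (M (bit_graph n s X)) (\<lambda>T. \<bar>?z i X T\<bar>))"
      by (intro integral_mono integrable_bits_pmf int abs_ge_self)
    also have "\<dots> \<le> exp \<epsilon> * sqrt n / 2 + n * \<delta>"
      by (rule row_correlation_le[OF alg dp i n P])
    finally show "measure_pmf.expectation (bits_pmf n s P) (\<lambda>X. measure_pmf.expectation (M (bit_graph n s X)) (?z i X))
      \<le> exp \<epsilon> * sqrt n / 2 + n * \<delta>" .
  qed
  finally show ?thesis by simp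
qed

text \<open>The identity of mean zero expresses the weight of the tree through its correlation with
  the bits and its size. Privacy bounds the former and acyclicity the latter.\<close>

lemma private_tree_integral_le:
  fixes n s :: nat and \<beta> \<epsilon> \<delta> :: real
  assumes alg: "mst_algorithm M" and dp: "differentially_private \<epsilon> \<delta> M"
    and pos: "n > 0" "s > 0" "\<beta> > 0"
  shows "(\<integral>G. measure_pmf.expectation (M G) (\<lambda>T. \<Sum>e\<in>T. weight G e) \<partial>hard_distribution n \<beta> s)
    \<le> s * n / 2 + s * (s / (2 * \<beta>) + 1) * (exp \<epsilon> * sqrt n / 2 + n * \<delta>)"
proof -
  interpret prob_space "prior n \<beta>" by (rule prob_space_prior[OF pos(3)])
  define R where "R = exp \<epsilon> * sqrt n / 2 + n * \<delta>"
  let ?G = "bit_graph n s"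
  let ?E = "complete_edges n"
  define q where "q = (\<lambda>X e. measure_pmf.prob (M (?G X)) {T. e \<in> T})"
  have tree_sum: "measure_pmf.expectation (M (?G X)) (\<lambda>T. \<Sum>e\<in>T. c e) = (\<Sum>e\<in>?E. q X e * c e)" for X c
    using expectation_tree_sum[OF alg connected_bit_graph, of n s X c] by (simp add: q_def)
  define U where "U = (\<lambda>P. measure_pmf.expectation (bits_pmf n s P) (\<lambda>X. \<Sum>e\<in>?E. q X e * edge_weight s X e))"
  define \<Phi> where "\<Phi> = (\<lambda>P. measure_pmf.expectation (bits_pmf n s P)
     (\<lambda>X. \<Sum>e\<in>?E. q X e * (edge_weight s X e + \<beta> - (s + 2 * \<beta>) * P e)))"
  have \<Phi>: "has_bochner_integral (prior n \<beta>) \<Phi> 0"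
    unfolding \<Phi>_def by (rule fingerprint_identity[OF pos(3)])
  have U_int: "integrable (prior n \<beta>) U"
    unfolding U_def by (rule integrable_bits_expectation[OF pos(3)])
  have size: "(\<Sum>e\<in>?E. q X e) \<le> n" for X
  proof -
    have "(\<Sum>e\<in>?E. q X e) = measure_pmf.expectation (M (?G X)) (\<lambda>T. card T)"
      using tree_sum[of X "\<lambda>_. 1"] by simp
    also have "\<dots> \<le> measure_pmf.expectation (M (?G X)) (\<lambda>T. n)"
    proof (intro integral_mono_AE AE_pmfI integrable_measure_pmf_finite
        finite_set_mst_algorithm[OF alg connected_bit_graph])
      fix T assume "T \<in> set_pmf (M (?G X))"
      hence "spanning_tree (?G X) T"
        using alg connected_bit_graph[of n s X] by (auto simp: mst_algorithm_def)
      from card_spanning_tree_le(2)[OF connected_bit_graph this] show "real (card T) \<le> real n" by simp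
    qed
    finally show ?thesis by simp
  qed
  \<comment> \<open>Eliminates \<open>p\<close> in favour of the deviation \<open>w - s * p\<close>.
    The weight \<open>w\<close> then enters with the negative coefficient
    \<open>- 2 * \<beta> / s\<close>, so an upper bound on the correlation becomes one on the
    weight.\<close>
  have split: "q * (w + \<beta> - (s + 2 * \<beta>) * p) = (1 + 2 * \<beta> / s) * (q * (w - s * p)) - 2 * \<beta> / s * (q * w) + \<beta> * q"
    for q w p :: real using pos by (simp add: field_simps)
  have bound: "\<Phi> P \<le> (s + 2 * \<beta>) * R - 2 * \<beta> / s * U P + \<beta> * n"
    if P: "\<forall>e\<in>?E. 0 < P e \<and> P e < 1" for P
  proof -
    let ?D = "measure_pmf.expectation (bits_pmf n s P) :: (_ \<Rightarrow> real) \<Rightarrow> real"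
    have "?D (\<lambda>X. \<Sum>e\<in>?E. q X e * (edge_weight s X e - s * P e)) \<le> s * R"
      using correlation_le[OF alg dp pos(1), of P s] P
      by (simp add: tree_sum R_def less_imp_le del: sum_of_bool_eq)
    hence corr: "(1 + 2 * \<beta> / s) * ?D (\<lambda>X. \<Sum>e\<in>?E. q X e * (edge_weight s X e - s * P e)) \<le> (1 + 2 * \<beta> / s) * (s * R)"
      using pos by (intro mult_left_mono) auto
    have "?D (\<lambda>X. \<Sum>e\<in>?E. q X e) \<le> ?D (\<lambda>X. n)"
      by (intro integral_mono integrable_bits_pmf size)
    hence K: "\<beta> * ?D (\<lambda>X. \<Sum>e\<in>?E. q X e) \<le> \<beta> * n"
      using pos by (intro mult_left_mono) auto
    have "\<Phi> P = (1 + 2 * \<beta> / s) * ?D (\<lambda>X. \<Sum>e\<in>?E. q X e * (edge_weight s X e - s * P e)) - 2 * \<beta> / s * U P +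
        \<beta> * ?D (\<lambda>X. \<Sum>e\<in>?E. q X e)"
      unfolding \<Phi>_def U_def split sum.distrib sum_subtractf sum_distrib_left[symmetric]
      by (simp only: Bochner_Integration.integral_add Bochner_Integration.integral_diff integral_mult_right_zero
            Bochner_Integration.integrable_diff integrable_bits_pmf)
    also have "\<dots> \<le> (1 + 2 * \<beta> / s) * (s * R) - 2 * \<beta> / s * U P + \<beta> * n"
      using corr K by linarith
    also have "(1 + 2 * \<beta> / s) * (s * R) = (s + 2 * \<beta>) * R" using pos by (simp add: field_simps)
    finally show ?thesis .
  qed
  have "AE P in prior n \<beta>. \<Phi> P \<le> (s + 2 * \<beta>) * R - 2 * \<beta> / s * U P + \<beta> * n"
    using AE_prior[OF pos(3), of n] by eventually_elim (rule bound)
  hence "(\<integral>P. \<Phi> P \<partial>prior n \<beta>) \<le> (\<integral>P. (s + 2 * \<beta>) * R - 2 * \<beta> / s * U P + \<beta> * n \<partial>prior n \<beta>)"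
    using \<Phi> U_int by (intro integral_mono_AE) (auto simp: has_bochner_integral_iff)
  also have "\<dots> = (s + 2 * \<beta>) * R - 2 * \<beta> / s * (\<integral>P. U P \<partial>prior n \<beta>) + \<beta> * n"
    using U_int by (simp add: prob_space)
  finally have "2 * \<beta> / s * (\<integral>P. U P \<partial>prior n \<beta>) \<le> (s + 2 * \<beta>) * R + \<beta> * n"
    using \<Phi> by (simp add: has_bochner_integral_iff)
  \<comment> \<open>Multiply by s / (2 \<beta>).\<close>
  hence "(\<integral>P. U P \<partial>prior n \<beta>) \<le> s * n / 2 + s * (s / (2 * \<beta>) + 1) * R"
    using pos by (simp add: field_simps)
  moreover have "(\<integral>G. measure_pmf.expectation (M G) (\<lambda>T. \<Sum>e\<in>T. weight G e) \<partial>hard_distribution n \<beta> s) =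
      (\<integral>P. U P \<partial>prior n \<beta>)"
  proof -
    have "measure_pmf.expectation (M (?G X)) (\<lambda>T. \<Sum>e\<in>T. weight (?G X) e) =
        (\<Sum>e\<in>?E. q X e * edge_weight s X e)" for X
      unfolding tree_sum by (intro sum.cong refl) (simp add: weight_bit_graph del: sum_of_bool_eq)
    thus ?thesis by (simp only: integral_hard_distribution[OF pos(3)] U_def)
  qed
  ultimately show ?thesis by (simp add: R_def)
qed

section \<open>Numerical estimates, with r for sqrt n and L for ln n\<close>

text \<open>The second summand is at most s times 0.011 r times 3.4 r, that is 0.0374 of s n, on top
  of one half. Since \<open>s\<close> is rounded, the two expressions for \<open>\<delta>\<close>
  need not coincide, and both are treated.\<close>

lemma upper_bound_numeric:
  fixes r L s \<beta> \<delta> :: real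
  assumes r: "r \<ge> 30000" and L: "L \<ge> 20" and s: "\<bar>s - r * L / 100\<bar> \<le> 1" and \<beta>: "\<beta> = L / 2"
    and \<delta>: "\<delta> = \<beta> * 0.04 / s \<or> \<delta> = 2 / r"
  shows "s * r\<^sup>2 / 2 + s * (s / (2 * \<beta>) + 1) * (exp 1 * r / 2 + r\<^sup>2 * \<delta>) \<le> 54 / 100 * (s * r\<^sup>2)"
proof -
  have rL: "r * L \<ge> 600000" using mult_mono[OF r L] r by simp
  \<comment> \<open>Rounding shifts \<open>s\<close> by at most 1, while r L / 100 is at least
    6000.\<close>
  have s0: "s \<ge> 999 / 100000 * (r * L)" "s > 0" using s rL by auto
  have R: "exp 1 * r / 2 + r\<^sup>2 * \<delta> \<le> 34 / 10 * r"
  proof -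
    have "exp 1 * r \<le> 272 / 100 * r" using e_less_272 r by (intro mult_right_mono) auto
    moreover have "r\<^sup>2 * \<delta> \<le> 201 / 100 * r"
      using \<delta>
    proof
      assume d: "\<delta> = \<beta> * 0.04 / s"
      have "r * L / 50 \<le> 201 / 100 * s" using s0 rL by linarith
      hence "r * (r * L / 50) \<le> r * (201 / 100 * s)" using r by (intro mult_left_mono) auto
      thus ?thesis using s0 by (simp add: d \<beta> field_simps power2_eq_square)
    next
      assume "\<delta> = 2 / r"
      thus ?thesis using r by (simp add: power2_eq_square)
    qed
    ultimately show ?thesis using r by linarith
  qed
  have "s \<le> r * L / 100 + 1" using s by linarith
  hence "s / (2 * \<beta>) \<le> (r * L / 100 + 1) / L" using L by (simp add: \<beta> divide_right_mono)
  also have "\<dots> = r / 100 + 1 / L" using L by (simp add: field_simps)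
  also have "1 / L \<le> 1 / 20" using L by (intro divide_left_mono) auto
  finally have c: "s / (2 * \<beta>) + 1 \<le> 0.011 * r" using r by simp
  have "s * (s / (2 * \<beta>) + 1) * (exp 1 * r / 2 + r\<^sup>2 * \<delta>) \<le> s * (0.011 * r) * (34 / 10 * r)"
  proof (rule mult_mono)
    show "s * (s / (2 * \<beta>) + 1) \<le> s * (0.011 * r)" using c s0 by (intro mult_left_mono) auto
    have "\<delta> \<ge> 0" using \<delta> r s0 L \<beta> by auto
    thus "0 \<le> exp 1 * r / 2 + r\<^sup>2 * \<delta>" using r by simp
  qed (use R s0 r in auto)
  also have "\<dots> = 0.0374 * (s * r\<^sup>2)" by (simp add: power2_eq_square)
  finally have "s * (s / (2 * \<beta>) + 1) * (exp 1 * r / 2 + r\<^sup>2 * \<delta>) \<le> 0.0374 * (s * r\<^sup>2)" .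
  moreover have "0 \<le> s * r\<^sup>2" using s0 by simp
  ultimately show ?thesis by simp
qed

text \<open>Drop the first hundredth of the vertices. For the others v q is at least r / 1000, and r
  \<ge> 30000 makes this at least 30; a heavy edge is then missing with probability at most 1/31,
  and 3/4 times 30/31 exceeds 0.72.\<close>

lemma lower_bound_numeric:
  fixes r q :: real and n :: nat
  assumes r: "r \<ge> 30000" and n: "real n = r\<^sup>2" and q: "1 / (10 * r) \<le> q" "q \<le> 1"
  shows "69 / 100 * r\<^sup>2 \<le> (\<Sum>v\<in>{1..<n}. 3 / 4 * (1 - (1 - q) ^ v))"
proof -
  have q0: "0 < q" using q r by (meson divide_pos_pos less_le_trans mult_pos_pos zero_less_numeral zero_less_one)
  define k where "k = nat \<lceil>r\<^sup>2 / 100\<rceil>"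
  have k: "r\<^sup>2 / 100 \<le> k" "k \<le> r\<^sup>2 / 100 + 1"
    unfolding k_def using of_nat_ceiling of_int_ceiling_le_add_one[of "r\<^sup>2 / 100"] by auto
  have r2: "r\<^sup>2 \<ge> 900000000" using mult_mono[OF r r] r by (simp add: power2_eq_square)
  have kn: "1 \<le> k" "k \<le> n" using k r2 n by linarith+
  have "69 / 100 * r\<^sup>2 \<le> (\<Sum>v\<in>{k..<n}. 0.72)"
    using k r2 n kn by (simp add: of_nat_diff)
  also have "\<dots> \<le> (\<Sum>v\<in>{k..<n}. 3 / 4 * (1 - (1 - q) ^ v))"
  proof (rule sum_mono)
    fix v assume "v \<in> {k..<n}"
    hence v: "r\<^sup>2 / 100 \<le> v" using k by simp
    have "30 \<le> r\<^sup>2 / 100 * (1 / (10 * r))" using r by (simp add: power2_eq_square field_simps)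
    also have "\<dots> \<le> v * q" using v q r by (intro mult_mono) auto
    finally have vq: "30 \<le> v * q" .
    have "(1 - q) ^ v \<le> 1 / (1 + v * q)" using q q0 by (intro one_minus_power_le) auto
    also have "\<dots> \<le> 1 / 31" using vq by (intro divide_left_mono) auto
    finally show "0.72 \<le> 3 / 4 * (1 - (1 - q) ^ v)" by simp
  qed
  also have "\<dots> \<le> (\<Sum>v\<in>{1..<n}. 3 / 4 * (1 - (1 - q) ^ v))"
    using kn q q0 by (intro sum_mono2) (auto intro!: power_le_one)
  finally show ?thesis .
qed

theorem theorem4p6:
  fixes n s :: nat and \<beta> \<gamma> \<delta> :: real
    and M :: "nat wgraph \<Rightarrow> nat set set pmf"
    and T_star :: "nat wgraph \<Rightarrow> nat set set"
  assumes n: "n \<ge> 9 * 10 ^ 8"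
    and beta: "\<beta> = 1 / 2 * ln (real n)"
    and s: "s = nat \<lfloor>1 / 100 * sqrt (real n) * ln (real n)\<rfloor> \<or>
            s = nat \<lceil>1 / 100 * sqrt (real n) * ln (real n)\<rceil>"
    and gamma: "\<gamma> = 0.04"
    and delta: "\<delta> = \<beta> * \<gamma> / real s \<or> \<delta> = 2 / sqrt (real n)"
    and alg: "mst_algorithm M"
    and dp: "differentially_private 1 \<delta> M"
    and T_star: "\<And>G. connected_wgraph G \<Longrightarrow> max_spanning_tree G (T_star G)"
  shows "(\<integral>G. measure_pmf.expectation (M G) (\<lambda>T. \<Sum>e\<in>T. weight G e) \<partial>hard_distribution n \<beta> s)
     \<le> (\<integral>G. (\<Sum>e\<in>T_star G. weight G e) \<partial>hard_distribution n \<beta> s)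
        - real n powr (3 / 2) * ln (real n) / 1000"
proof -
  define r where "r = sqrt (real n)"
  define L where "L = ln (real n)"
  have n': "real n \<ge> 900000000" using n by simp
  hence n0: "n > 0" by simp
  have r2: "real n = r\<^sup>2" by (simp add: r_def)
  have r: "r \<ge> 30000" unfolding r_def using n' by (intro real_le_rsqrt) simp
  have L: "L \<ge> 20"
  proof -
    have "exp 20 = exp (1::real) ^ 20" by (simp flip: exp_of_nat_mult)
    also have "\<dots> \<le> 2.72 ^ 20" using e_less_272 by (intro power_mono) auto
    also have "\<dots> \<le> real n" using n' by (simp add: power_divide)
    finally show ?thesis unfolding L_def using n' by (subst ln_ge_iff) auto
  qed
  have \<beta>: "\<beta> = L / 2" by (simp add: beta L_def)
  have rL: "r * L \<ge> 600000" using mult_mono[OF r L] r by simp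
  have s': "\<bar>s - r * L / 100\<bar> \<le> 1"
    using s rL unfolding r_def[symmetric] L_def[symmetric] by (auto simp: mult.assoc) linarith+
  have s0: "s \<ge> 999 / 100000 * (r * L)" "s > 0" using s' rL by auto
  have s_pos: "s > 0" and \<beta>_pos: "\<beta> > 0" using s0 L \<beta> by auto
  define q where "q = measure (beta_distr \<beta> \<beta>) {3/4..}"
  \<comment> \<open>The choice of \<open>\<beta>\<close> as half of ln n makes a heavy edge have
    probability at least 1 / (10 sqrt n), so a typical vertex sees many of them.\<close>
  have "exp (- \<beta>) = 1 / r"
  proof -
    have "exp \<beta> = r"
      using n' by (simp add: r_def \<beta> L_def powr_half_sqrt[symmetric] powr_def)
    thus ?thesis by (simp add: exp_minus inverse_eq_divide)
  qed
  hence q: "1 / (10 * r) \<le> q" "q \<le> 1"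
    using beta_distr_tail[of \<beta>] prob_space.prob_le_1[OF prob_space_beta_distr[of \<beta> \<beta>]] L
    by (auto simp: \<beta> q_def)
  have "(\<integral>G. measure_pmf.expectation (M G) (\<lambda>T. \<Sum>e\<in>T. weight G e) \<partial>hard_distribution n \<beta> s)
      \<le> s * r\<^sup>2 / 2 + s * (s / (2 * \<beta>) + 1) * (exp 1 * r / 2 + r\<^sup>2 * \<delta>)"
    using private_tree_integral_le[OF alg dp n0 s_pos \<beta>_pos]
    by (simp only: r_def[symmetric] r2[symmetric] of_nat_mult)
  also have "\<dots> \<le> 54 / 100 * (s * r\<^sup>2)"
    using delta by (intro upper_bound_numeric[OF r L s' \<beta>]) (simp add: gamma r_def)
  finally have upper: "(\<integral>G. measure_pmf.expectation (M G) (\<lambda>T. \<Sum>e\<in>T. weight G e) \<partial>hard_distribution n \<beta> s)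
      \<le> 54 / 100 * (s * r\<^sup>2)" .
  have "69 / 100 * (s * r\<^sup>2) = s * (69 / 100 * r\<^sup>2)" by simp
  also have "\<dots> \<le> s * (\<Sum>v\<in>{1..<n}. 3 / 4 * (1 - (1 - q) ^ v))"
    by (rule mult_left_mono[OF lower_bound_numeric[OF r r2 q]]) simp
  also have "\<dots> \<le> (\<integral>G. (\<Sum>e\<in>T_star G. weight G e) \<partial>hard_distribution n \<beta> s)"
    unfolding q_def by (rule max_tree_integral_ge[OF T_star \<beta>_pos])
  finally have lower: "69 / 100 * (s * r\<^sup>2) \<le> (\<integral>G. (\<Sum>e\<in>T_star G. weight G e) \<partial>hard_distribution n \<beta> s)" .
  have "real n powr (3 / 2) = (real n powr (1 / 2)) powr 3" by (simp add: powr_powr)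
  also have "\<dots> = r ^ 3" using r by (simp add: powr_half_sqrt r_def[symmetric])
  finally have "real n powr (3 / 2) * ln (real n) = r\<^sup>2 * (r * L)"
    by (simp add: L_def power3_eq_cube power2_eq_square)
  \<comment> \<open>The gap between 0.69 and 0.54 is 0.15, which is 150/1000; the true ratio of r L
    to s is close to 100.\<close>
  also have "\<dots> \<le> r\<^sup>2 * (150 * s)" using s0 rL by (intro mult_left_mono) auto
  finally have "real n powr (3 / 2) * ln (real n) \<le> 150 * (s * r\<^sup>2)" by (simp add: mult_ac)
  with upper lower show ?thesis by linarith
qed

end
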